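(* Let $\mathcal{X}=\mathcal{Y}=[0,1]^{\mathbb{N}}$ with $\mu_X=\mu_Y$, the basis functions $(p_{jk})$ and the index sets $\mathcal{J}=\mathcal{K}$ as described in the context. Fix $\alpha,\beta\in(0,1)$ such that $\alpha+\beta<1$, and $r,s_X,s_Y,A>0$. For $j\in\mathcal{J}$, $k\in\mathcal{K}$ let $\theta_{jk}=\exp(s_X|j|^{1/2})\vee\exp(s_Y|k|^{1/2})$ (with the convention $\theta_{jk}=\infty$ if $|j|=0$ or $|k|=0$), and let $\xi=(\theta,r,A)\in\Xi$, where $\Xi:=[0,\infty]^{\mathcal{J}\times\mathcal{K}}\times(0,\infty)\times[1,\infty)$. Let $s:=2/(s_X^{-1}+s_Y^{-1})$ and $c_0:=\sum_{\ell=1}^\infty\{\ell^{-1/2}-(\ell+1)^{-1/2}\}\log(1+\ell)=1.65\ldots$, and suppose that $r^2\le n^{s/(s+c_0)-\epsilon}$ for some $\epsilon>0$. Then there exist $C=C(\alpha,\beta,s_X,s_Y,A,\epsilon)>0$ and $C'=C'(\alpha,\beta,s_X,s_Y,A,\epsilon)>0$, depending only on the indicated quantities, such that when $\min(n,nr^2)\ge C'$ we have $$\rho^*(n,\alpha,\beta,\xi)\ge\frac{C\,m_{0,s_X,s_Y}^{1/4}(nr^2)}{n^{1/2}}.$$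
   Context: $n\in\mathbb{N}$ is the sample size. $\mathbb{N}_0^{<\infty}$ is the set of sequences $m=(m_1,m_2,\ldots)$ of non-negative integers with finitely many non-zero entries; $\mathcal{J}=\mathcal{K}:=\{(a,m):a\in\{0,1\},m\in\mathbb{N}_0^{<\infty}\}\setminus\{(1,0)\}$. For $m\in\mathbb{N}_0^{<\infty}$, $|m|:=\max_{\ell\in\mathbb{N}}\ell^2m_\ell$, and for $j=(a,m)$, $|j|:=|m|$. $\mathcal{X}=\mathcal{Y}=[0,1]^{\mathbb{N}}$ carries the Borel $\sigma$-algebra of the product topology, and $\mu_X=\mu_Y$ is the distribution of an infinite i.i.d. sequence of $\mathrm{Unif}[0,1]$ random variables; $\mu:=\mu_X\otimes\mu_Y$. The orthonormal basis functions used are $p_{0,0}^X:=1$ and, for $m\ne0$, $$p_{a,m}^X(x_1,x_2,\ldots):=2^{1/2}\mathrm{Re}\Bigl(e^{-a\pi i/2}\prod_{\ell=1}^\infty e^{-2\pi im_\ell x_\ell}\Bigr),$$ with $p_{a,m}^Y=p_{a,m}^X$ and $p_{jk}(x,y):=p_j^X(x)p_k^Y(y)$. Define $M:[0,\infty)\to[0,\infty)$ by $M(t):=\exp\bigl(\sum_{\ell=1}^\infty\log(1+\lfloor t/\ell^2\rfloor)\bigr)-1$ and $$m_{0,s_X,s_Y}(t):=\min\biggl\{m\in\mathbb{N}:M\Bigl(\frac{\log^2(t/m^{1/2})}{4s_X^2}\Bigr)M\Bigl(\frac{\log^2(t/m^{1/2})}{4s_Y^2}\Bigr)<\frac m4\biggr\}.$$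 $\mathcal{F}$ is the set of probability densities $f\in L^2(\mu)$ with respect to $\mu$, with marginal densities $f_X,f_Y$. $a_{jk}(f):=\int fp_{jk}\,d\mu$, $a_{j\bullet}(f):=\int f_Xp_j^X\,d\mu_X$, $a_{\bullet k}(f):=\int f_Yp_k^Y\,d\mu_Y$, $$D(f):=\int\{f(x,y)-f_X(x)f_Y(y)\}^2\,d\mu(x,y),\qquad S_\theta(f):=\sum_{j,k}\theta_{jk}^2\{a_{jk}(f)-a_{j\bullet}(f)a_{\bullet k}(f)\}^2$$ (with $\infty\cdot0=0$), and for $\rho>0$ $$\mathcal{F}_\xi(\rho):=\{f\in\mathcal{F}:D(f)\ge\rho^2,\ S_\theta(f)\le r^2,\ \max(\|f\|_\infty,\|f_X\|_\infty,\|f_Y\|_\infty)\le A\},$$ where $\|\cdot\|_\infty$ is the supremum norm. $\Psi$ is the set of measurable $\psi:(\mathcal{X}\times\mathcal{Y})^n\to[0,1]$; $\mathbb{E}_P(\psi)$ (or $\mathbb{E}_f(\psi)$) is the expectation of $\psi(X_1,Y_1,\ldots,X_n,Y_n)$ for i.i.d. pairs with distribution $P$ (or density $f$). $\mathcal{P}_0$ is the set of all distributions on $\mathcal{X}\times\mathcal{Y}$ of pairs $(X,Y)$ with $X,Y$ independent, $\Psi(\alpha):=\{\psi\in\Psi:\sup_{P\in\mathcal{P}_0}\mathbb{E}_P(\psi)\le\alpha\}$, $$\mathcal{R}(n,\alpha,\xi,\rho):=\alpha+\inf_{\psi\in\Psi(\alpha)}\sup_{f\in\mathcal{F}_\xi(\rho)}\mathbb{E}_f(1-\psi)$$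 (equal to $\alpha$ if $\mathcal{F}_\xi(\rho)=\emptyset$), and $\rho^*(n,\alpha,\beta,\xi):=\inf\{\rho>0:\mathcal{R}(n,\alpha,\xi,\rho)\le\alpha+\beta\}$.
   Formalization: A > 1 is assumed instead of A ≥ 1: for A = 1 every admissible density equals 1 almost everywhere, so there are no alternatives, ρ* = 0, and the positive lower bound fails. c_0 is the infinite series; its value is about 2.17, so the decimal 1.65… is dropped. *)

theory Defs
  imports "HOL-Probability.Probability"
begin

text \<open>
  Coordinates \<open>\<ell> = 1, 2, \<dots>\<close> are represented by \<open>l = 0, 1, \<dots>\<close> with \<open>\<ell> = Suc l\<close>, for points
  of the cube as well as for multi-indices.
\<close>

definition cube :: "(nat \<Rightarrow> real) measure" where
  "cube = PiM UNIV (\<lambda>_. restrict_space lborel {0..1})"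

lemma prob_space_unif: "prob_space (restrict_space lborel {0..1::real})"
  by (rule prob_spaceI) (simp add: emeasure_restrict_space space_restrict_space)

lemma prob_space_cube: "prob_space cube"
proof -
  interpret product_prob_space "\<lambda>_. restrict_space lborel {0..1::real}" UNIV
    by (intro product_prob_spaceI prob_space_unif)
  show ?thesis unfolding cube_def by (rule P.prob_space_axioms)
qed

lemma space_cube: "space cube = {x. \<forall>l. x l \<in> {0..1}}"
  by (auto simp: cube_def space_PiM space_restrict_space PiE_def Pi_def)

lemma sets_cube: "sets cube = sets (restrict_space borel {x. \<forall>l. x l \<in> {0..1}})"
proof (rule antisym)
  have id_PiM: "(\<lambda>x. x) \<in> measurable (restrict_space borel {x. \<forall>l. x l \<in> {0..1}}) cube"
    unfolding cube_def
  proof (rule measurable_PiM_single')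
    fix l :: nat
    have "(\<lambda>x::nat \<Rightarrow> real. x l) \<in> measurable borel borel"
      by (intro borel_measurable_continuous_onI) (auto intro: continuous_intros)
    then show "(\<lambda>x. x l) \<in> measurable (restrict_space borel {x. \<forall>l. x l \<in> {0..1}})
        (restrict_space lborel {0..1::real})"
      by (intro measurable_restrict_space2)
        (auto intro: measurable_restrict_space1 simp: space_restrict_space)
  qed (auto simp: space_restrict_space)
  show "sets cube \<subseteq> sets (restrict_space borel {x. \<forall>l. x l \<in> {0..1}})"
  proof
    fix S assume S: "S \<in> sets cube"
    have "S \<subseteq> space cube" using S by (rule sets.sets_into_space)
    then show "S \<in> sets (restrict_space borel {x. \<forall>l. x l \<in> {0..1}})"
      using measurable_sets[OF id_PiM S]
      by (simp add: space_restrict_space space_cube Int_absorb2)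
  qed
  have "(\<lambda>x. x) \<in> measurable cube (PiM UNIV (\<lambda>_. borel :: real measure))"
  proof (rule measurable_PiM_single')
    fix l :: nat
    have "(\<lambda>x. x l) \<in> measurable cube (restrict_space lborel {0..1::real})"
      unfolding cube_def by (rule measurable_component_singleton) simp
    then show "(\<lambda>x. x l) \<in> measurable cube (borel :: real measure)"
      by (simp add: measurable_restrict_space2_iff)
  qed auto
  then have id_borel: "(\<lambda>x. x) \<in> measurable cube borel"
    by (simp cong: measurable_cong_sets add: sets_PiM_equal_borel)
  show "sets (restrict_space borel {x. \<forall>l. x l \<in> {0..1}}) \<subseteq> sets cube"
  proof
    fix S assume "S \<in> sets (restrict_space borel {x::nat \<Rightarrow> real. \<forall>l. x l \<in> {0..1}})"
    then obtain B where B: "B \<in> sets borel" "S = {x. \<forall>l. x l \<in> {0..1}} \<inter> B"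
      by (auto simp: sets_restrict_space)
    show "S \<in> sets cube"
      using measurable_sets[OF id_borel B(1)] by (simp add: B(2) space_cube Int_commute)
  qed
qed

definition cube2 :: "((nat \<Rightarrow> real) \<times> (nat \<Rightarrow> real)) measure" where
  "cube2 = cube \<Otimes>\<^sub>M cube"

definition multi_indices :: "(nat \<Rightarrow> nat) set" where
  "multi_indices = {m. finite {l. m l \<noteq> 0}}"

definition indices :: "(nat \<times> (nat \<Rightarrow> nat)) set" where
  "indices = {0, 1} \<times> multi_indices - {(1, \<lambda>_. 0)}"

definition idx_size :: "nat \<times> (nat \<Rightarrow> nat) \<Rightarrow> nat" where
  "idx_size j = Max (range (\<lambda>l. (Suc l)\<^sup>2 * snd j l))"

definition basis :: "nat \<times> (nat \<Rightarrow> nat) \<Rightarrow> (nat \<Rightarrow> real) \<Rightarrow> real" where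
  "basis j x = (case j of (a, m) \<Rightarrow>
     if m = (\<lambda>_. 0) then 1
     else sqrt 2 * Re (exp (- (of_nat a * of_real pi * \<i> / 2)) *
            (\<Prod>l. exp (- (2 * of_real pi * \<i> * of_nat (m l) * of_real (x l))))))"

definition basis2 :: "nat \<times> (nat \<Rightarrow> nat) \<Rightarrow> nat \<times> (nat \<Rightarrow> nat) \<Rightarrow>
    (nat \<Rightarrow> real) \<times> (nat \<Rightarrow> real) \<Rightarrow> real" where
  "basis2 j k z = basis j (fst z) * basis k (snd z)"

definition marg_X :: "((nat \<Rightarrow> real) \<times> (nat \<Rightarrow> real) \<Rightarrow> real) \<Rightarrow> (nat \<Rightarrow> real) \<Rightarrow> real" where
  "marg_X f x = (\<integral>y. f (x, y) \<partial>cube)"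

definition marg_Y :: "((nat \<Rightarrow> real) \<times> (nat \<Rightarrow> real) \<Rightarrow> real) \<Rightarrow> (nat \<Rightarrow> real) \<Rightarrow> real" where
  "marg_Y f y = (\<integral>x. f (x, y) \<partial>cube)"

definition coeff_XY where
  "coeff_XY f j k = (\<integral>z. f z * basis2 j k z \<partial>cube2)"

definition coeff_X where
  "coeff_X f j = (\<integral>x. marg_X f x * basis j x \<partial>cube)"

definition coeff_Y where
  "coeff_Y f k = (\<integral>y. marg_Y f y * basis k y \<partial>cube)"

definition dependence :: "((nat \<Rightarrow> real) \<times> (nat \<Rightarrow> real) \<Rightarrow> real) \<Rightarrow> real" where
  "dependence f = (\<integral>z. (f z - marg_X f (fst z) * marg_Y f (snd z))\<^sup>2 \<partial>cube2)"

type_synonym weights = "nat \<times> (nat \<Rightarrow> nat) \<Rightarrow> nat \<times> (nat \<Rightarrow> nat) \<Rightarrow> ennreal"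

text \<open>The convention \<open>\<infinity> \<cdot> 0 = 0\<close> is built into multiplication on \<^typ>\<open>ennreal\<close>.\<close>

definition sobolev_sum :: "weights \<Rightarrow> ((nat \<Rightarrow> real) \<times> (nat \<Rightarrow> real) \<Rightarrow> real) \<Rightarrow> ennreal" where
  "sobolev_sum \<theta> f = (\<Sum>\<^sub>\<infinity>(j, k) \<in> indices \<times> indices.
     (\<theta> j k)\<^sup>2 * ennreal ((coeff_XY f j k - coeff_X f j * coeff_Y f k)\<^sup>2))"

definition densities :: "((nat \<Rightarrow> real) \<times> (nat \<Rightarrow> real) \<Rightarrow> real) set" where
  "densities = {f \<in> borel_measurable cube2.
     (\<forall>z \<in> space cube2. 0 \<le> f z) \<and> integrable cube2 (\<lambda>z. (f z)\<^sup>2) \<and> (\<integral>z. f z \<partial>cube2) = 1}"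

text \<open>A genuine supremum over the sample space, not an essential supremum.\<close>

definition sup_norm :: "'a measure \<Rightarrow> ('a \<Rightarrow> real) \<Rightarrow> ennreal" where
  "sup_norm M f = (SUP x \<in> space M. ennreal \<bar>f x\<bar>)"

definition alternatives :: "weights \<times> real \<times> real \<Rightarrow> real \<Rightarrow>
    ((nat \<Rightarrow> real) \<times> (nat \<Rightarrow> real) \<Rightarrow> real) set" where
  "alternatives \<xi> \<rho> = (case \<xi> of (\<theta>, r, A) \<Rightarrow>
     {f \<in> densities. dependence f \<ge> \<rho>\<^sup>2 \<and> sobolev_sum \<theta> f \<le> ennreal (r\<^sup>2) \<and>
        max (sup_norm cube2 f) (max (sup_norm cube (marg_X f)) (sup_norm cube (marg_Y f)))
          \<le> ennreal A})"

definition tests :: "nat \<Rightarrow> ((nat \<Rightarrow> (nat \<Rightarrow> real) \<times> (nat \<Rightarrow> real)) \<Rightarrow> real) set" where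
  "tests n = {\<psi> \<in> borel_measurable (PiM {..<n} (\<lambda>_. cube2)).
     \<forall>\<omega> \<in> space (PiM {..<n} (\<lambda>_. cube2)). 0 \<le> \<psi> \<omega> \<and> \<psi> \<omega> \<le> 1}"

definition sample_expectation :: "nat \<Rightarrow> 'a measure \<Rightarrow> ((nat \<Rightarrow> 'a) \<Rightarrow> real) \<Rightarrow> real" where
  "sample_expectation n P \<psi> = (\<integral>\<omega>. \<psi> \<omega> \<partial>PiM {..<n} (\<lambda>_. P))"

definition null_distributions :: "((nat \<Rightarrow> real) \<times> (nat \<Rightarrow> real)) measure set" where
  "null_distributions = {P. prob_space P \<and> sets P = sets cube2 \<and>
     prob_space.indep_var P cube fst cube snd}"

definition level_tests :: "nat \<Rightarrow> real \<Rightarrow> ((nat \<Rightarrow> (nat \<Rightarrow> real) \<times> (nat \<Rightarrow> real)) \<Rightarrow> real) set" where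
  "level_tests n \<alpha> = {\<psi> \<in> tests n. (SUP P \<in> null_distributions. sample_expectation n P \<psi>) \<le> \<alpha>}"

definition minimax_risk :: "nat \<Rightarrow> real \<Rightarrow> weights \<times> real \<times> real \<Rightarrow> real \<Rightarrow> real" where
  "minimax_risk n \<alpha> \<xi> \<rho> = (if alternatives \<xi> \<rho> = {} then \<alpha> else
     \<alpha> + (INF \<psi> \<in> level_tests n \<alpha>. SUP f \<in> alternatives \<xi> \<rho>.
            sample_expectation n (density cube2 (\<lambda>z. ennreal (f z))) (\<lambda>\<omega>. 1 - \<psi> \<omega>)))"

definition separation_radius :: "nat \<Rightarrow> real \<Rightarrow> real \<Rightarrow> weights \<times> real \<times> real \<Rightarrow> ereal" where
  "separation_radius n \<alpha> \<beta> \<xi> = (INF \<rho> \<in> {\<rho>. 0 < \<rho> \<and> minimax_risk n \<alpha> \<xi> \<rho> \<le> \<alpha> + \<beta>}. ereal \<rho>)"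

definition exp_weights :: "real \<Rightarrow> real \<Rightarrow> weights" where
  "exp_weights s\<^sub>X s\<^sub>Y j k = (if idx_size j = 0 \<or> idx_size k = 0 then \<infinity>
     else ennreal (max (exp (s\<^sub>X * sqrt (idx_size j))) (exp (s\<^sub>Y * sqrt (idx_size k)))))"

definition M_fun :: "real \<Rightarrow> real" where
  "M_fun t = exp (\<Sum>l. ln (1 + real_of_int \<lfloor>t / (real (Suc l))\<^sup>2\<rfloor>)) - 1"

definition m0 :: "real \<Rightarrow> real \<Rightarrow> real \<Rightarrow> nat" where
  "m0 s\<^sub>X s\<^sub>Y t = (LEAST m. 0 < m \<and>
     M_fun ((ln (t / sqrt m))\<^sup>2 / (4 * s\<^sub>X\<^sup>2)) * M_fun ((ln (t / sqrt m))\<^sup>2 / (4 * s\<^sub>Y\<^sup>2)) < m / 4)"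

definition harmonic_smoothness :: "real \<Rightarrow> real \<Rightarrow> real" where
  "harmonic_smoothness s\<^sub>X s\<^sub>Y = 2 / (1 / s\<^sub>X + 1 / s\<^sub>Y)"

definition c0 :: real where
  "c0 = (\<Sum>l. (1 / sqrt (real (Suc l)) - 1 / sqrt (real (Suc l) + 1)) * ln (1 + real (Suc l)))"

text \<open>
  For \<open>A = 1\<close> there are no alternatives at all, so that the separation radius is 0; positive lower
  bounds on it therefore need \<open>A > 1\<close>.
\<close>

lemma alternatives_A_eq_1:
  assumes "\<rho> > 0"
  shows "alternatives (\<theta>, r, 1) \<rho> = {}"
proof (rule ccontr)
  interpret C: prob_space cube by (rule prob_space_cube)
  interpret pair_prob_space cube cube ..
  have P: "prob_space cube2" unfolding cube2_def by (rule prob_space_axioms)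
  interpret D: prob_space cube2 by (rule P)
  assume "alternatives (\<theta>, r, 1) \<rho> \<noteq> {}"
  then obtain f where f: "f \<in> borel_measurable cube2" "\<And>z. z \<in> space cube2 \<Longrightarrow> 0 \<le> f z"
      "(\<integral>z. f z \<partial>cube2) = 1" "dependence f \<ge> \<rho>\<^sup>2" "sup_norm cube2 f \<le> 1"
    by (auto simp: alternatives_def densities_def)
  have le1: "f z \<le> 1" if "z \<in> space cube2" for z
  proof -
    have "ennreal \<bar>f z\<bar> \<le> sup_norm cube2 f"
      unfolding sup_norm_def using that by (rule SUP_upper)
    then have "ennreal \<bar>f z\<bar> \<le> 1" using f(5) by (rule order_trans)
    then show ?thesis by simp
  qed
  have int: "integrable cube2 f"
    using f(3) not_integrable_integral_eq by fastforce
  have "(\<integral>z. 1 - f z \<partial>cube2) = 0"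
    using int f(3) D.prob_space by simp
  then have ae: "AE z in cube2. f z = 1"
    using integral_nonneg_eq_0_iff_AE[of cube2 "\<lambda>z. 1 - f z"] int le1 by auto
  have fm [measurable]: "f \<in> borel_measurable (cube \<Otimes>\<^sub>M cube)"
    using f(1) by (simp only: cube2_def)
  have aeXY: "AE x in cube. AE y in cube. f (x, y) = 1"
    using AE_pair[of "\<lambda>z. f z = 1"] ae by (simp only: cube2_def)
  have aeYX: "AE y in cube. AE x in cube. f (x, y) = 1"
    using aeXY by (subst AE_commute) measurable
  have X: "AE x in cube. marg_X f x = 1"
    using aeXY
  proof (rule AE_mp, intro AE_I2 impI)
    fix x assume x: "x \<in> space cube" "AE y in cube. f (x, y) = 1"
    have "marg_X f x = (\<integral>y. 1 \<partial>cube)"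
      unfolding marg_X_def by (rule integral_cong_AE) (use x in measurable)
    then show "marg_X f x = 1" by (simp add: C.prob_space)
  qed
  have Y: "AE y in cube. marg_Y f y = 1"
    using aeYX
  proof (rule AE_mp, intro AE_I2 impI)
    fix y assume y: "y \<in> space cube" "AE x in cube. f (x, y) = 1"
    have "marg_Y f y = (\<integral>x. 1 \<partial>cube)"
      unfolding marg_Y_def by (rule integral_cong_AE) (use y in measurable)
    then show "marg_Y f y = 1" by (simp add: C.prob_space)
  qed
  have [measurable]: "marg_X f \<in> borel_measurable cube" "marg_Y f \<in> borel_measurable cube"
    unfolding marg_X_def [abs_def] marg_Y_def [abs_def] by measurable
  have "AE x in cube. AE y in cube. f (x, y) - marg_X f x * marg_Y f y = 0"
    using aeXY X
  proof eventually_elim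
    case (elim x)
    show ?case using elim(1) Y by eventually_elim (simp add: elim(2))
  qed
  then have "AE x in cube. AE y in cube.
      f (x, y) - marg_X f (fst (x, y)) * marg_Y f (snd (x, y)) = 0"
    by simp
  then have "AE z in cube \<Otimes>\<^sub>M cube. f z - marg_X f (fst z) * marg_Y f (snd z) = 0"
    by (intro AE_pair_measure) measurable
  then have "AE z in cube2. f z - marg_X f (fst z) * marg_Y f (snd z) = 0"
    by (simp only: cube2_def)
  then have "AE z in cube2. (f z - marg_X f (fst z) * marg_Y f (snd z))\<^sup>2 = 0"
    by eventually_elim simp
  then have "dependence f = 0"
    unfolding dependence_def by (rule integral_eq_zero_AE)
  with f(4) assms show False by simp
qed

end

theory Submission
  imports Defs "HOL-Real_Asymp.Real_Asymp"
begin

text \<open>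
  The bound compares the uniform density with a random alternative, following Le Cam. Let \<open>m\<close> be the predecessor of
  \<open>m0 s\<^sub>X s\<^sub>Y t\<close> for \<open>t = n r\<^sup>2\<close>. Since \<open>m\<close> fails the inequality that defines \<open>m0\<close>, there are at least
  \<open>m\<close> pairs of nonconstant basis functions whose squared weight is at most \<open>t / sqrt m\<close>: the function
  \<open>M_fun\<close> counts nonzero multi-indices of bounded size (\<open>card_frequencies\<close>). Choose a set \<open>S\<close> of \<open>m\<close>
  such pairs and perturb the uniform density by \<open>\<delta>\<close> times the sum over \<open>S\<close> of \<open>\<plusminus>\<close> the corresponding products.
  Both marginals of the perturbed density are uniform, so its dependence is \<open>\<delta>\<^sup>2 m\<close> and its
  smoothness functional is at most \<open>\<delta>\<^sup>2 m t / sqrt m\<close>. With \<open>\<delta>\<^sup>2 = c / (n sqrt m)\<close> and \<open>c \<le> 1\<close> the latter is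
  at most \<open>r\<^sup>2\<close>, while \<open>\<delta>\<^sup>2 m = c sqrt m / n\<close> is the square of the separation that is claimed.

  By orthonormality, the chi-square distance between the uniform sample and the mixture of the
  perturbed samples over all signs is at most \<open>exp (c\<^sup>2 / 2) - 1\<close> (\<open>sum_signs_power_le\<close>). For small \<open>c\<close>
  the error of the second kind of a test of level \<open>\<alpha>\<close> on the mixture is then at least nearly \<open>1 - \<alpha>\<close>, hence
  larger than \<open>\<beta>\<close> (\<open>mixture_type_II_error\<close>).

  What remains is that a perturbed function has to be nonnegative and bounded by \<open>A\<close>. This may
  fail for some choices of signs, so the mixture is restricted to those for which it holds; as long as
  these are almost all signs, the chi-square bound hardly changes. At a fixed point the random sum is of order \<open>sqrt m\<close>
  with Gaussian tails. The functions involved depend on \<open>O(log n)\<close> coordinates and have frequencies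
  \<open>O(log\<^sup>2 n)\<close>, so a grid with \<open>exp (O(log\<^sup>2 n))\<close> points controls the supremum
  (\<open>card_signs_large_sup\<close>). Hence it suffices that \<open>\<delta> sqrt m = sqrt (c sqrt m / n)\<close> decays like a power
  of \<open>n\<close>. This is where the bound on \<open>r\<close> enters: \<open>1 + M_fun t \<le> exp (c0 sqrt t)\<close>
  (\<open>M_fun_le\<close>) turns it into \<open>sqrt m / n \<le> 2 n powr (-\<kappa>)\<close> with \<open>\<kappa> = s / (s + c0)\<close>
  (\<open>sqrt_coefficient_number_le\<close>).
\<close>

section \<open>Trigonometric functions on the cube\<close>

lemma measurable_cube_component [measurable]: "(\<lambda>x. x l) \<in> borel_measurable cube"
proof -
  have "(\<lambda>x. x l) \<in> measurable cube (restrict_space lborel {0..1::real})"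
    unfolding cube_def by (rule measurable_component_singleton) simp
  then show ?thesis by (simp add: measurable_restrict_space2_iff)
qed

lemma integral_character_unit_interval:
  fixes k :: int
  shows "(\<integral>u. cis (2 * pi * (of_int k * u)) \<partial>restrict_space lborel {0..1::real}) = (if k = 0 then 1 else 0)"
proof (cases "k = 0")
  case True
  then show ?thesis
    using prob_space.prob_space[OF prob_space_unif] by simp
next
  case False
  define F :: "real \<Rightarrow> complex" where
    "F u = cis (2 * pi * (of_int k * u)) / (\<i> * of_real (2 * pi * of_int k))" for u
  have "(F has_vector_derivative cis (2 * pi * (of_int k * u))) (at u within {0..1})" for u
    unfolding F_def has_vector_derivative_def
    by (rule derivative_eq_intros refl | simp add: False)+
       (auto simp: fun_eq_iff False scaleR_conv_of_real field_simps)
  then have "(\<integral>u. indicator {0..1} u *\<^sub>R cis (2 * pi * (of_int k * u)) \<partial>lborel) = F 1 - F 0"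
    by (intro integral_FTC_atLeastAtMost) (auto intro!: continuous_intros)
  also have "F 1 = F 0"
    using cis_multiple_2pi[of "of_int k"] by (simp add: F_def mult_ac)
  finally show ?thesis
    using False by (simp add: integral_restrict_space)
qed

text \<open>
  Only finitely many coordinates enter, so the integral of the character factorises over them; a
  nonzero frequency in one coordinate makes its factor vanish.
\<close>

lemma integral_cos_cube:
  fixes k :: "nat \<Rightarrow> int"
  shows "(\<integral>x. cos (2 * pi * (\<Sum>l<N. of_int (k l) * x l) + c) \<partial>cube) = (if \<forall>l<N. k l = 0 then cos c else 0)"
proof -
  interpret product_prob_space "\<lambda>_. restrict_space lborel {0..1::real}" "UNIV :: nat set"
    by (intro product_prob_spaceI prob_space_unif)
  interpret C: prob_space cube by (rule prob_space_cube)
  define e :: "nat \<Rightarrow> real \<Rightarrow> complex" where "e l u = cis (2 * pi * (of_int (k l) * u))" for l u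
  have e_meas [measurable]: "e l \<in> borel_measurable (restrict_space lborel {0..1})" for l
    unfolding e_def
    by (intro measurable_restrict_space1) (auto intro!: borel_measurable_continuous_onI continuous_intros)
  have e_int: "integrable (restrict_space lborel {0..1}) (e l)" for l
    by (rule finite_measure.integrable_const_bound[where B = 1])
       (auto simp: e_def intro!: prob_space.finite_measure prob_space_unif e_meas[unfolded e_def])
  have prod_e: "(\<Prod>l<N. e l (x l)) = cis (2 * pi * (\<Sum>l<N. of_int (k l) * x l))" for x :: "nat \<Rightarrow> real"
    by (induction N) (simp_all add: e_def cis_mult distrib_left)
  have meas_cis: "(\<lambda>x. cis (2 * pi * (\<Sum>l<N. of_int (k l) * x l) + c)) \<in> borel_measurable cube"
    by (rule borel_measurable_continuous_on[of cis]) (auto intro!: continuous_intros)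
  have "(\<integral>x. (\<Prod>l<N. e l (x l)) \<partial>cube)
      = (\<integral>x. (\<Prod>l<N. e l (x l)) \<partial>distr cube (PiM {..<N} (\<lambda>_. restrict_space lborel {0..1})) (\<lambda>x. restrict x {..<N}))"
    by (subst integral_distr) (auto simp: cube_def)
  also have "\<dots> = (\<Prod>l<N. \<integral>u. e l u \<partial>restrict_space lborel {0..1})"
    unfolding cube_def by (subst distr_PiM_restrict_finite) (auto intro!: product_integral_prod e_int)
  also have "\<dots> = (\<Prod>l<N. if k l = 0 then 1 else 0)"
    unfolding e_def integral_character_unit_interval ..
  also have "\<dots> = (if \<forall>l<N. k l = 0 then 1 else 0)"
    by (auto intro: prod_zero)
  finally have I: "(\<integral>x. cis (2 * pi * (\<Sum>l<N. of_int (k l) * x l)) \<partial>cube) = (if \<forall>l<N. k l = 0 then 1 else 0)"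
    by (simp add: prod_e)
  have "(\<integral>x. cos (2 * pi * (\<Sum>l<N. of_int (k l) * x l) + c) \<partial>cube)
      = (\<integral>x. Re (cis (2 * pi * (\<Sum>l<N. of_int (k l) * x l) + c)) \<partial>cube)"
    by simp
  also have "\<dots> = Re (\<integral>x. cis (2 * pi * (\<Sum>l<N. of_int (k l) * x l) + c) \<partial>cube)"
    by (intro integral_Re C.integrable_const_bound[where B = 1] meas_cis) auto
  also have "(\<integral>x. cis (2 * pi * (\<Sum>l<N. of_int (k l) * x l) + c) \<partial>cube)
      = (\<integral>x. cis c * cis (2 * pi * (\<Sum>l<N. of_int (k l) * x l)) \<partial>cube)"
    by (simp add: cis_mult add.commute)
  also have "\<dots> = cis c * (if \<forall>l<N. k l = 0 then 1 else 0)"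
    by (simp add: I)
  finally show ?thesis
    by auto
qed

lemma finite_support_bound:
  assumes "m \<in> multi_indices"
  obtains N where "\<And>l. N \<le> l \<Longrightarrow> m l = 0"
proof -
  have "finite {l. m l \<noteq> 0}" using assms by (simp add: multi_indices_def)
  then obtain N where "\<forall>l\<in>{l. m l \<noteq> 0}. l < N" by (meson finite_nat_set_iff_bounded)
  then show ?thesis using that[of N] by (metis mem_Collect_eq not_le)
qed

lemma basis_eq_cos:
  assumes "\<And>l. N \<le> l \<Longrightarrow> m l = 0" and "m \<noteq> (\<lambda>_. 0)"
  shows "basis (a, m) x = sqrt 2 * cos (2 * pi * (\<Sum>l<N. of_nat (m l) * x l) + a * pi / 2)"
proof -
  have "(\<Prod>l. exp (- (2 * of_real pi * \<i> * of_nat (m l) * of_real (x l))))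
      = (\<Prod>l<N. exp (- (2 * of_real pi * \<i> * of_nat (m l) * of_real (x l))))"
    by (rule prodinf_finite) (auto simp: assms(1))
  also have "\<dots> = cis (- (2 * pi * (\<Sum>l<N. of_nat (m l) * x l)))"
    by (simp add: exp_sum [symmetric] cis_conv_exp sum_negf sum_distrib_left mult_ac)
  finally have "basis (a, m) x
      = sqrt 2 * Re (cis (- (a * pi / 2)) * cis (- (2 * pi * (\<Sum>l<N. of_nat (m l) * x l))))"
    using assms(2) by (simp add: basis_def cis_conv_exp mult_ac)
  also have "\<dots> = sqrt 2 * cos (- (2 * pi * (\<Sum>l<N. of_nat (m l) * x l) + a * pi / 2))"
    unfolding cis_mult by (simp add: algebra_simps)
  finally show ?thesis by (simp only: cos_minus)
qed

lemma basis_zero [simp]: "basis (a, \<lambda>_. 0) x = 1"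
  by (simp add: basis_def)

lemma measurable_basis:
  assumes "j \<in> indices"
  shows "basis j \<in> borel_measurable cube"
proof (cases j)
  case (Pair a m)
  then obtain N where N: "\<And>l. N \<le> l \<Longrightarrow> m l = 0"
    using assms finite_support_bound[of m] by (auto simp: indices_def)
  show ?thesis
  proof (cases "m = (\<lambda>_. 0)")
    case True
    then show ?thesis using Pair by (simp add: basis_def [abs_def])
  next
    case False
    have "basis j = (\<lambda>x. sqrt 2 * cos (2 * pi * (\<Sum>l<N. of_nat (m l) * x l) + a * pi / 2))"
      using basis_eq_cos[of N m, OF N False] Pair by auto
    then show ?thesis by simp
  qed
qed

lemma abs_basis_le:
  assumes "j \<in> indices"
  shows "\<bar>basis j x\<bar> \<le> sqrt 2"
proof (cases j)
  case (Pair a m)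
  then obtain N where N: "\<And>l. N \<le> l \<Longrightarrow> m l = 0"
    using assms finite_support_bound[of m] by (auto simp: indices_def)
  show ?thesis
  proof (cases "m = (\<lambda>_. 0)")
    case False
    show ?thesis
      using basis_eq_cos[of N m, OF N False] Pair
      by (simp add: abs_mult mult_left_le)
  qed (use Pair in simp)
qed

lemma integrable_cube_bounded:
  fixes f :: "_ \<Rightarrow> real"
  assumes "f \<in> borel_measurable cube" "\<And>x. \<bar>f x\<bar> \<le> B"
  shows "integrable cube f"
proof -
  interpret C: prob_space cube by (rule prob_space_cube)
  show ?thesis by (rule C.integrable_const_bound[where B = B]) (use assms in auto)
qed

lemma integral_basis:
  assumes "j \<in> indices"
  shows "(\<integral>x. basis j x \<partial>cube) = (if j = (0, \<lambda>_. 0) then 1 else 0)"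
proof (cases j)
  case (Pair a m)
  then obtain N where N: "\<And>l. N \<le> l \<Longrightarrow> m l = 0"
    using assms finite_support_bound[of m] by (auto simp: indices_def)
  show ?thesis
  proof (cases "m = (\<lambda>_. 0)")
    case True
    interpret C: prob_space cube by (rule prob_space_cube)
    show ?thesis using True Pair assms by (auto simp: indices_def C.prob_space)
  next
    case False
    have ex: "\<exists>l<N. m l \<noteq> 0" using False N by (metis ext not_le)
    have "(\<integral>x. cos (2 * pi * (\<Sum>l<N. of_nat (m l) * x l) + a * pi / 2) \<partial>cube) = 0"
      using integral_cos_cube[where N = N and k = "\<lambda>l. int (m l)" and c = "a * pi / 2"] ex by auto
    then show ?thesis
      using basis_eq_cos[of N m, OF N False] False Pair by simp
  qed
qed

text \<open>
  The product of two cosines is half the sum of the cosines of the sum and of the difference of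
  their phases. The sum of two nonzero multi-indices is never zero, so only the difference can
  contribute, and it does so exactly when the multi-indices agree. The remaining phase \<open>(a - b) \<pi> / 2\<close> then
  separates the cosine from the sine.
\<close>

lemma basis_orthonormal:
  assumes "j \<in> indices" "k \<in> indices"
  shows "(\<integral>x. basis j x * basis k x \<partial>cube) = (if j = k then 1 else 0)"
proof -
  interpret C: prob_space cube by (rule prob_space_cube)
  obtain a m b m' where jk: "j = (a, m)" "k = (b, m')" by (metis surj_pair)
  have ab: "a \<in> {0,1}" "b \<in> {0,1}" "m \<in> multi_indices" "m' \<in> multi_indices"
    using assms jk by (auto simp: indices_def)
  consider "m = (\<lambda>_. 0)" | "m' = (\<lambda>_. 0)" | "m \<noteq> (\<lambda>_. 0)" "m' \<noteq> (\<lambda>_. 0)" by blast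
  then show ?thesis
  proof cases
    case 1
    then have "j = (0, \<lambda>_. 0)" using jk assms by (auto simp: indices_def)
    then show ?thesis using integral_basis[OF assms(2)] by auto
  next
    case 2
    then have "k = (0, \<lambda>_. 0)" using jk assms by (auto simp: indices_def)
    then show ?thesis using integral_basis[OF assms(1)] by auto
  next
    case 3
    obtain N1 where N1: "\<And>l. N1 \<le> l \<Longrightarrow> m l = 0" using finite_support_bound[OF ab(3)] by blast
    obtain N2 where N2: "\<And>l. N2 \<le> l \<Longrightarrow> m' l = 0" using finite_support_bound[OF ab(4)] by blast
    define N where "N = max N1 N2"
    have N: "\<And>l. N \<le> l \<Longrightarrow> m l = 0" "\<And>l. N \<le> l \<Longrightarrow> m' l = 0"
      using N1 N2 by (auto simp: N_def)
    define P where "P x = cos (2 * pi * (\<Sum>l<N. of_int (int (m l) - int (m' l)) * x l) + (real a - real b) * pi / 2)" for x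
    define Q where "Q x = cos (2 * pi * (\<Sum>l<N. of_int (int (m l) + int (m' l)) * x l) + (real a + real b) * pi / 2)" for x
    have PQ: "basis j x * basis k x = P x + Q x" for x
    proof -
      define u where "u = 2 * pi * (\<Sum>l<N. of_nat (m l) * x l) + a * pi / 2"
      define v where "v = 2 * pi * (\<Sum>l<N. of_nat (m' l) * x l) + b * pi / 2"
      have "P x = cos (u - v)" "Q x = cos (u + v)"
        unfolding P_def Q_def u_def v_def
        by (simp_all add: algebra_simps sum.distrib sum_subtractf diff_divide_distrib add_divide_distrib)
      moreover have "basis j x * basis k x = (sqrt 2 * cos u) * (sqrt 2 * cos v)"
        using basis_eq_cos[of N m, OF N(1) 3(1)] basis_eq_cos[of N m', OF N(2) 3(2)]
        unfolding jk u_def v_def by simp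
      moreover have "(sqrt 2 * cos u) * (sqrt 2 * cos v) = 2 * (cos u * cos v)"
        by (simp add: mult_ac)
      ultimately show ?thesis
        by (simp add: cos_add cos_diff)
    qed
    have "(\<integral>x. basis j x * basis k x \<partial>cube) = (\<integral>x. P x \<partial>cube) + (\<integral>x. Q x \<partial>cube)"
      unfolding PQ
      by (intro Bochner_Integration.integral_add integrable_cube_bounded[where B = 1])
         (auto simp: P_def Q_def)
    also have "(\<integral>x. Q x \<partial>cube) = 0"
    proof -
      have "\<exists>l<N. m l \<noteq> 0" using 3(1) N by (metis ext not_le)
      then show ?thesis unfolding Q_def integral_cos_cube by auto
    qed
    also have "(\<integral>x. P x \<partial>cube) = (if j = k then 1 else 0)"
    proof (cases "m = m'")
      case True
      then show ?thesis
        unfolding P_def integral_cos_cube using ab by (auto simp: jk)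
    next
      case False
      then have "\<exists>l<N. m l \<noteq> m' l" using N by (metis ext not_le)
      then show ?thesis
        unfolding P_def integral_cos_cube using False by (auto simp: jk)
    qed
    finally show ?thesis by simp
  qed
qed

section \<open>Random signs\<close>

definition signs :: "'i set \<Rightarrow> ('i \<Rightarrow> real) set" where
  "signs S = PiE S (\<lambda>_. {-1, 1})"

lemma finite_signs: "finite S \<Longrightarrow> finite (signs S)"
  unfolding signs_def by (intro finite_PiE) auto

lemma card_signs: "finite S \<Longrightarrow> card (signs S) = 2 ^ card S"
  unfolding signs_def by (subst card_PiE) (auto simp: numeral_2_eq_2)

lemma signs_square: "\<zeta> \<in> signs S \<Longrightarrow> i \<in> S \<Longrightarrow> (\<zeta> i)\<^sup>2 = 1"
  by (auto simp: signs_def PiE_def Pi_def power2_eq_1_iff)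

lemma signs_abs: "\<zeta> \<in> signs S \<Longrightarrow> i \<in> S \<Longrightarrow> \<bar>\<zeta> i\<bar> = 1"
  using signs_square[of \<zeta> S i] by (auto simp: power2_eq_1_iff)

text \<open>
  Hoeffding's lemma for a fair coin on \<open>{-\<bar>x\<bar>, \<bar>x\<bar>}\<close>.
\<close>

lemma cosh_le_exp_half_square: "cosh (x::real) \<le> exp (x\<^sup>2 / 2)"
proof -
  have "- (2 * \<bar>x\<bar>) * (1/2) + ln (1 + 1/2 * (exp (2 * \<bar>x\<bar>) - 1)) \<le> (2 * \<bar>x\<bar>)\<^sup>2 / 8"
    by (rule Hoeffdings_lemma_aux) auto
  then have "ln (1 + 1/2 * (exp (2 * \<bar>x\<bar>) - 1)) \<le> x\<^sup>2 / 2 + \<bar>x\<bar>"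
    by (simp add: power_mult_distrib)
  moreover have "0 < 1 + 1/2 * (exp (2 * \<bar>x\<bar>) - 1 :: real)"
    using exp_gt_zero[of "2 * \<bar>x\<bar>"] by (simp add: field_simps del: exp_gt_zero)
  ultimately have "1 + 1/2 * (exp (2 * \<bar>x\<bar>) - 1) \<le> exp (x\<^sup>2 / 2 + \<bar>x\<bar>)"
    by (metis exp_ln exp_le_cancel_iff)
  then have "exp (- \<bar>x\<bar>) * (1 + 1/2 * (exp (2 * \<bar>x\<bar>) - 1)) \<le> exp (- \<bar>x\<bar>) * exp (x\<^sup>2 / 2 + \<bar>x\<bar>)"
    by (intro mult_left_mono) auto
  also have "exp (- \<bar>x\<bar>) * exp (x\<^sup>2 / 2 + \<bar>x\<bar>) = exp (x\<^sup>2 / 2)"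
    by (simp add: exp_add [symmetric])
  also have "exp (- \<bar>x\<bar>) * (1 + 1/2 * (exp (2 * \<bar>x\<bar>) - 1)) = cosh \<bar>x\<bar>"
  proof -
    have "exp (- \<bar>x\<bar>) * exp (2 * \<bar>x\<bar>) = exp \<bar>x\<bar>" by (simp add: exp_add [symmetric])
    then show ?thesis by (simp add: cosh_def algebra_simps)
  qed
  finally show ?thesis by (simp add: cosh_real_abs)
qed

text \<open>
  The exponential moment of a Rademacher sum: independence turns it into a product of hyperbolic
  cosines. Averages over random signs are written as sums over the finite set of all sign vectors.
\<close>

lemma sum_signs_exp_le:
  assumes S: "finite S"
  shows "(\<Sum>\<zeta>\<in>signs S. exp (\<Sum>i\<in>S. \<zeta> i * a i)) \<le> 2 ^ card S * exp ((\<Sum>i\<in>S. (a i)\<^sup>2) / 2)"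
proof -
  have "(\<Sum>\<zeta>\<in>signs S. exp (\<Sum>i\<in>S. \<zeta> i * a i)) = (\<Sum>\<zeta>\<in>signs S. \<Prod>i\<in>S. exp (\<zeta> i * a i))"
    unfolding exp_sum[OF S] ..
  also have "\<dots> = (\<Prod>i\<in>S. \<Sum>y\<in>{-1, 1}. exp (y * a i))"
    unfolding signs_def by (rule prod_sum_PiE [symmetric]) (use S in auto)
  also have "\<dots> = (\<Prod>i\<in>S. 2 * cosh (a i))"
  proof (rule prod.cong [OF refl])
    fix i
    show "(\<Sum>y\<in>{-1, 1}. exp (y * a i)) = 2 * cosh (a i)"
      by (simp add: cosh_def)
  qed
  also have "\<dots> \<le> (\<Prod>i\<in>S. 2 * exp ((a i)\<^sup>2 / 2))"
    by (rule prod_mono) (use cosh_le_exp_half_square in \<open>simp add: less_imp_le[OF cosh_real_pos]\<close>)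
  also have "\<dots> = 2 ^ card S * exp ((\<Sum>i\<in>S. (a i)\<^sup>2) / 2)"
    unfolding sum_divide_distrib exp_sum[OF S] prod.distrib prod_constant ..
  finally show ?thesis .
qed

text \<open>
  Chernoff's bound at the optimal parameter \<open>u / V\<close>.
\<close>

lemma card_signs_tail:
  assumes S: "finite S" and V: "(\<Sum>i\<in>S. (a i)\<^sup>2) \<le> V" "0 < V" and u: "0 \<le> u"
  shows "card {\<zeta>\<in>signs S. u \<le> (\<Sum>i\<in>S. \<zeta> i * a i)} \<le> 2 ^ card S * exp (- (u\<^sup>2 / (2 * V)))"
proof -
  let ?B = "{\<zeta>\<in>signs S. u \<le> (\<Sum>i\<in>S. \<zeta> i * a i)}"
  define t where "t = u / V"
  have t: "0 \<le> t" using u V by (simp add: t_def)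
  have "real (card ?B) * exp (t * u) = (\<Sum>\<zeta>\<in>?B. exp (t * u))"
    by (simp only: sum_constant)
  also have "\<dots> \<le> (\<Sum>\<zeta>\<in>?B. exp (\<Sum>i\<in>S. \<zeta> i * (t * a i)))"
  proof (rule sum_mono)
    fix \<zeta> assume "\<zeta> \<in> ?B"
    then have "t * u \<le> t * (\<Sum>i\<in>S. \<zeta> i * a i)" using t by (intro mult_left_mono) auto
    then show "exp (t * u) \<le> exp (\<Sum>i\<in>S. \<zeta> i * (t * a i))"
      by (simp add: sum_distrib_left mult_ac)
  qed
  also have "\<dots> \<le> (\<Sum>\<zeta>\<in>signs S. exp (\<Sum>i\<in>S. \<zeta> i * (t * a i)))"
    by (rule sum_mono2) (use S finite_signs in auto)
  also have "\<dots> \<le> 2 ^ card S * exp ((\<Sum>i\<in>S. (t * a i)\<^sup>2) / 2)"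
    by (rule sum_signs_exp_le[OF S])
  also have "(\<Sum>i\<in>S. (t * a i)\<^sup>2) = t\<^sup>2 * (\<Sum>i\<in>S. (a i)\<^sup>2)"
    by (simp add: power_mult_distrib sum_distrib_left)
  also have "2 ^ card S * exp (t\<^sup>2 * (\<Sum>i\<in>S. (a i)\<^sup>2) / 2) \<le> 2 ^ card S * exp (t\<^sup>2 * V / 2)"
    using V by (auto intro!: mult_left_mono)
  finally have "real (card ?B) \<le> 2 ^ card S * exp (t\<^sup>2 * V / 2) / exp (t * u)"
    by (simp add: field_simps)
  also have "\<dots> = 2 ^ card S * exp (t\<^sup>2 * V / 2 - t * u)"
    by (simp add: exp_diff)
  also have "t\<^sup>2 * V / 2 - t * u = - (u\<^sup>2 / (2 * V))"
    using V by (simp add: t_def field_simps power2_eq_square)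
  finally show ?thesis .
qed

lemma card_signs_tail_union:
  assumes S: "finite S" and Z: "finite Z" and V: "\<And>z. z \<in> Z \<Longrightarrow> (\<Sum>i\<in>S. (a z i)\<^sup>2) \<le> V" "0 < V"
    and u: "0 \<le> u"
  shows "card {\<zeta>\<in>signs S. \<exists>z\<in>Z. u \<le> \<bar>\<Sum>i\<in>S. \<zeta> i * a z i\<bar>}
    \<le> 2 ^ card S * (2 * real (card Z) * exp (- (u\<^sup>2 / (2 * V))))"
proof -
  let ?U = "\<lambda>z. {\<zeta>\<in>signs S. u \<le> (\<Sum>i\<in>S. \<zeta> i * a z i)}"
  let ?L = "\<lambda>z. {\<zeta>\<in>signs S. u \<le> (\<Sum>i\<in>S. \<zeta> i * (- a z i))}"
  let ?q = "2 ^ card S * exp (- (u\<^sup>2 / (2 * V)))"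
  have fin: "finite (?U z)" "finite (?L z)" for z using finite_signs[OF S] by auto
  have "{\<zeta>\<in>signs S. \<exists>z\<in>Z. u \<le> \<bar>\<Sum>i\<in>S. \<zeta> i * a z i\<bar>} \<subseteq> (\<Union>z\<in>Z. ?U z \<union> ?L z)"
    by (auto simp: sum_negf abs_if split: if_splits)
  then have "card {\<zeta>\<in>signs S. \<exists>z\<in>Z. u \<le> \<bar>\<Sum>i\<in>S. \<zeta> i * a z i\<bar>} \<le> card (\<Union>z\<in>Z. ?U z \<union> ?L z)"
    by (intro card_mono) (use fin Z in auto)
  also have "\<dots> \<le> (\<Sum>z\<in>Z. card (?U z \<union> ?L z))"
    by (rule card_UN_le[OF Z])
  also have "\<dots> \<le> (\<Sum>z\<in>Z. card (?U z) + card (?L z))"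
    by (intro sum_mono card_Un_le)
  finally have "real (card {\<zeta>\<in>signs S. \<exists>z\<in>Z. u \<le> \<bar>\<Sum>i\<in>S. \<zeta> i * a z i\<bar>})
      \<le> real (\<Sum>z\<in>Z. card (?U z) + card (?L z))"
    by (simp only: of_nat_le_iff)
  also have "\<dots> = (\<Sum>z\<in>Z. real (card (?U z)) + real (card (?L z)))"
    by (simp only: of_nat_sum of_nat_add)
  also have "\<dots> \<le> (\<Sum>z\<in>Z. ?q + ?q)"
  proof (intro sum_mono add_mono)
    fix z assume z: "z \<in> Z"
    show "real (card (?U z)) \<le> ?q"
      by (rule card_signs_tail[OF S V(1)[OF z] V(2) u])
    show "real (card (?L z)) \<le> ?q"
      by (rule card_signs_tail[OF S _ V(2) u]) (use V(1)[OF z] in simp)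
  qed
  also have "\<dots> = 2 ^ card S * (2 * real (card Z) * exp (- (u\<^sup>2 / (2 * V))))"
    by simp
  finally show ?thesis .
qed

text \<open>
  The second moment of the mixed likelihood ratio. Since \<open>1 + x \<le> exp x\<close>, each term is
  bounded by the exponential of a Rademacher sum in \<open>\<zeta>'\<close>; the bound is positive, so that the sum may
  be extended from \<open>G\<close> to all sign vectors.
\<close>

lemma sum_signs_power_le:
  fixes d :: real
  assumes S: "finite S" and G: "G \<subseteq> signs S"
    and nonneg: "\<And>\<zeta> \<zeta>'. \<zeta> \<in> G \<Longrightarrow> \<zeta>' \<in> G \<Longrightarrow> 0 \<le> 1 + d * (\<Sum>i\<in>S. \<zeta> i * \<zeta>' i)"
  shows "(\<Sum>\<zeta>\<in>G. \<Sum>\<zeta>'\<in>G. (1 + d * (\<Sum>i\<in>S. \<zeta> i * \<zeta>' i)) ^ n)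
    \<le> (2 ^ card S)\<^sup>2 * exp (card S * (n * d)\<^sup>2 / 2)"
proof -
  have fin: "finite (signs S)" using S by (rule finite_signs)
  have "(\<Sum>\<zeta>\<in>G. \<Sum>\<zeta>'\<in>G. (1 + d * (\<Sum>i\<in>S. \<zeta> i * \<zeta>' i)) ^ n)
      \<le> (\<Sum>\<zeta>\<in>G. \<Sum>\<zeta>'\<in>G. exp (\<Sum>i\<in>S. \<zeta>' i * (n * d * \<zeta> i)))"
  proof (intro sum_mono)
    fix \<zeta> \<zeta>' assume "\<zeta> \<in> G" "\<zeta>' \<in> G"
    then have "(1 + d * (\<Sum>i\<in>S. \<zeta> i * \<zeta>' i)) ^ n \<le> exp (d * (\<Sum>i\<in>S. \<zeta> i * \<zeta>' i)) ^ n"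
      by (intro power_mono nonneg exp_ge_add_one_self)
    also have "\<dots> = exp (\<Sum>i\<in>S. \<zeta>' i * (n * d * \<zeta> i))"
      by (simp add: exp_of_nat_mult [symmetric] sum_distrib_left mult_ac)
    finally show "(1 + d * (\<Sum>i\<in>S. \<zeta> i * \<zeta>' i)) ^ n \<le> exp (\<Sum>i\<in>S. \<zeta>' i * (n * d * \<zeta> i))" .
  qed
  also have "\<dots> \<le> (\<Sum>\<zeta>\<in>signs S. \<Sum>\<zeta>'\<in>signs S. exp (\<Sum>i\<in>S. \<zeta>' i * (n * d * \<zeta> i)))"
  proof -
    let ?e = "\<lambda>\<zeta> \<zeta>'. exp (\<Sum>i\<in>S. \<zeta>' i * (real n * d * \<zeta> i))"
    have "(\<Sum>\<zeta>\<in>G. sum (?e \<zeta>) G) \<le> (\<Sum>\<zeta>\<in>G. sum (?e \<zeta>) (signs S))"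
      by (intro sum_mono sum_mono2 fin G exp_ge_zero)
    also have "\<dots> \<le> (\<Sum>\<zeta>\<in>signs S. sum (?e \<zeta>) (signs S))"
      by (intro sum_mono2 fin G sum_nonneg exp_ge_zero)
    finally show ?thesis .
  qed
  also have "\<dots> \<le> (\<Sum>\<zeta>\<in>signs S. 2 ^ card S * exp (card S * (n * d)\<^sup>2 / 2))"
  proof (rule sum_mono)
    fix \<zeta> assume z: "\<zeta> \<in> signs S"
    have "(\<Sum>i\<in>S. (n * d * \<zeta> i)\<^sup>2) = card S * (n * d)\<^sup>2"
      using signs_square[OF z] by (simp add: power_mult_distrib)
    then show "(\<Sum>\<zeta>'\<in>signs S. exp (\<Sum>i\<in>S. \<zeta>' i * (n * d * \<zeta> i))) \<le> 2 ^ card S * exp (card S * (n * d)\<^sup>2 / 2)"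
      using sum_signs_exp_le[OF S, of "\<lambda>i. n * d * \<zeta> i"] by simp
  qed
  also have "\<dots> = (2 ^ card S)\<^sup>2 * exp (card S * (n * d)\<^sup>2 / 2)"
    using S by (simp add: card_signs power2_eq_square)
  finally show ?thesis .
qed

section \<open>Perturbations of the uniform density\<close>

lemma prob_space_cube2: "prob_space cube2"
proof -
  interpret C: prob_space cube by (rule prob_space_cube)
  interpret pair_prob_space cube cube ..
  show ?thesis unfolding cube2_def by (rule prob_space_axioms)
qed

lemma integral_cube2_product:
  fixes f g :: "_ \<Rightarrow> real"
  assumes f: "f \<in> borel_measurable cube" "\<And>x. \<bar>f x\<bar> \<le> B" and g: "g \<in> borel_measurable cube" "\<And>x. \<bar>g x\<bar> \<le> B"
  shows "(\<integral>z. f (fst z) * g (snd z) \<partial>cube2) = (\<integral>x. f x \<partial>cube) * (\<integral>x. g x \<partial>cube)"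
proof -
  interpret C: prob_space cube by (rule prob_space_cube)
  interpret pair_prob_space cube cube ..
  note [measurable] = f(1) g(1)
  have "0 \<le> B" using f(2) by (meson abs_ge_zero order_trans)
  then have "integrable (cube \<Otimes>\<^sub>M cube) (\<lambda>z. f (fst z) * g (snd z))"
    by (intro integrable_const_bound[where B = "B * B"]) (use f g in \<open>auto simp: abs_mult intro!: mult_mono\<close>)
  then have "(\<integral>z. f (fst z) * g (snd z) \<partial>cube2) = (\<integral>x. (\<integral>y. f x * g y \<partial>cube) \<partial>cube)"
    unfolding cube2_def using integral_fst[of "\<lambda>x y. f x * g y"] by (simp add: case_prod_beta')
  then show ?thesis by simp
qed

lemma measurable_basis2:
  assumes "j \<in> indices" "k \<in> indices"
  shows "basis2 j k \<in> borel_measurable cube2"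
proof -
  note [measurable] = measurable_basis[OF assms(1)] measurable_basis[OF assms(2)]
  show ?thesis unfolding basis2_def [abs_def] cube2_def by measurable
qed

lemma abs_basis2_le:
  assumes "j \<in> indices" "k \<in> indices"
  shows "\<bar>basis2 j k z\<bar> \<le> 2"
proof -
  have "\<bar>basis2 j k z\<bar> \<le> sqrt 2 * sqrt 2"
    unfolding basis2_def abs_mult using assms by (intro mult_mono abs_basis_le) auto
  then show ?thesis by simp
qed

lemma integrable_cube2_bounded:
  fixes f :: "_ \<Rightarrow> real"
  assumes "f \<in> borel_measurable cube2" "\<And>x. x \<in> space cube2 \<Longrightarrow> \<bar>f x\<bar> \<le> B"
  shows "integrable cube2 f"
proof -
  interpret C: prob_space cube2 by (rule prob_space_cube2)
  show ?thesis by (rule C.integrable_const_bound[where B = B]) (use assms in auto)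
qed

lemma basis2_orthonormal:
  assumes "j \<in> indices" "k \<in> indices" "j' \<in> indices" "k' \<in> indices"
  shows "(\<integral>z. basis2 j k z * basis2 j' k' z \<partial>cube2) = (if j = j' \<and> k = k' then 1 else 0)"
proof -
  have bound: "\<bar>basis i x * basis i' x\<bar> \<le> 2" if "i \<in> indices" "i' \<in> indices" for i i' x
  proof -
    have "\<bar>basis i x * basis i' x\<bar> \<le> sqrt 2 * sqrt 2"
      unfolding abs_mult using that by (intro mult_mono abs_basis_le) auto
    then show ?thesis by simp
  qed
  have "(\<integral>z. basis2 j k z * basis2 j' k' z \<partial>cube2)
      = (\<integral>z. (basis j (fst z) * basis j' (fst z)) * (basis k (snd z) * basis k' (snd z)) \<partial>cube2)"
    by (simp add: basis2_def mult_ac)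
  also have "\<dots> = (\<integral>x. basis j x * basis j' x \<partial>cube) * (\<integral>x. basis k x * basis k' x \<partial>cube)"
    by (rule integral_cube2_product[where B = 2])
       (use assms bound in \<open>auto intro!: borel_measurable_times measurable_basis\<close>)
  also have "\<dots> = (if j = j' \<and> k = k' then 1 else 0)"
    using assms by (simp add: basis_orthonormal)
  finally show ?thesis .
qed

abbreviation nonconstant_indices :: "(nat \<times> (nat \<Rightarrow> nat)) set" where
  "nonconstant_indices \<equiv> indices - {(0, \<lambda>_. 0)}"

lemma zero_index: "(0, \<lambda>_. 0) \<in> indices"
  by (simp add: indices_def multi_indices_def)

lemma integral_basis_nonconstant:
  "j \<in> nonconstant_indices \<Longrightarrow> (\<integral>x. basis j x \<partial>cube) = 0"
  using integral_basis[of j] by auto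

definition signed_sum where
  "signed_sum S \<zeta> z = (\<Sum>jk\<in>S. \<zeta> jk * basis2 (fst jk) (snd jk) z)"

text \<open>
  Both indices of every pair in \<open>S\<close> differ from the constant function, so that a perturbation
  along \<open>S\<close> leaves the marginals uniform.
\<close>

locale perturbation =
  fixes S :: "((nat \<times> (nat \<Rightarrow> nat)) \<times> (nat \<times> (nat \<Rightarrow> nat))) set"
  assumes finite: "finite S" and nonconstant: "S \<subseteq> nonconstant_indices \<times> nonconstant_indices"
begin

definition perturbed :: "real \<Rightarrow> _ \<Rightarrow> _ \<Rightarrow> real" where
  "perturbed \<delta> \<zeta> z = 1 + \<delta> * signed_sum S \<zeta> z"

lemma S_indices: "i \<in> S \<Longrightarrow> fst i \<in> indices" "i \<in> S \<Longrightarrow> snd i \<in> indices"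
  using nonconstant by auto

lemma S_nonconstant: "i \<in> S \<Longrightarrow> fst i \<in> nonconstant_indices" "i \<in> S \<Longrightarrow> snd i \<in> nonconstant_indices"
  using nonconstant by auto

lemma measurable_signed_sum: "signed_sum S \<zeta> \<in> borel_measurable cube2"
  unfolding signed_sum_def [abs_def]
  by (intro borel_measurable_sum borel_measurable_times borel_measurable_const measurable_basis2 S_indices)

lemma integrable_basis2_product:
  assumes "j \<in> indices" "k \<in> indices" "j' \<in> indices" "k' \<in> indices"
  shows "integrable cube2 (\<lambda>z. basis2 j k z * basis2 j' k' z)"
  by (rule integrable_cube2_bounded[where B = "2 * 2"])
     (use assms in \<open>auto simp: abs_mult intro!: borel_measurable_times measurable_basis2 mult_mono[OF abs_basis2_le abs_basis2_le, simplified]\<close>)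

lemma signed_sum_coefficient:
  assumes jk: "j \<in> indices" "k \<in> indices"
  shows "integrable cube2 (\<lambda>z. signed_sum S \<zeta> z * basis2 j k z)"
    and "(\<integral>z. signed_sum S \<zeta> z * basis2 j k z \<partial>cube2) = (if (j, k) \<in> S then \<zeta> (j, k) else 0)"
proof -
  have eq: "signed_sum S \<zeta> z * basis2 j k z = (\<Sum>i\<in>S. \<zeta> i * (basis2 (fst i) (snd i) z * basis2 j k z))" for z
    by (simp add: signed_sum_def sum_distrib_right mult.assoc)
  have int: "integrable cube2 (\<lambda>z. \<zeta> i * (basis2 (fst i) (snd i) z * basis2 j k z))" if "i \<in> S" for i
    using that jk by (intro integrable_mult_right integrable_basis2_product S_indices)
  show "integrable cube2 (\<lambda>z. signed_sum S \<zeta> z * basis2 j k z)"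
    unfolding eq using int by (rule Bochner_Integration.integrable_sum)
  have "(\<integral>z. signed_sum S \<zeta> z * basis2 j k z \<partial>cube2)
      = (\<Sum>i\<in>S. \<zeta> i * (\<integral>z. basis2 (fst i) (snd i) z * basis2 j k z \<partial>cube2))"
    unfolding eq using int by (subst Bochner_Integration.integral_sum) auto
  also have "\<dots> = (\<Sum>i\<in>S. if i = (j, k) then \<zeta> i else 0)"
    by (rule sum.cong [OF refl]) (use jk S_indices in \<open>auto simp: basis2_orthonormal prod_eq_iff\<close>)
  also have "\<dots> = (if (j, k) \<in> S then \<zeta> (j, k) else 0)"
    using finite by simp
  finally show "(\<integral>z. signed_sum S \<zeta> z * basis2 j k z \<partial>cube2) = (if (j, k) \<in> S then \<zeta> (j, k) else 0)" .
qed

lemma signed_sum_inner_product: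
  shows "integrable cube2 (\<lambda>z. signed_sum S \<zeta> z * signed_sum S \<zeta>' z)"
    and "(\<integral>z. signed_sum S \<zeta> z * signed_sum S \<zeta>' z \<partial>cube2) = (\<Sum>i\<in>S. \<zeta> i * \<zeta>' i)"
proof -
  have eq: "signed_sum S \<zeta> z * signed_sum S \<zeta>' z
      = (\<Sum>i\<in>S. \<zeta>' i * (signed_sum S \<zeta> z * basis2 (fst i) (snd i) z))" for z
    by (subst (2) signed_sum_def) (simp add: sum_distrib_left mult_ac)
  have int: "integrable cube2 (\<lambda>z. \<zeta>' i * (signed_sum S \<zeta> z * basis2 (fst i) (snd i) z))" if "i \<in> S" for i
    using that by (intro integrable_mult_right signed_sum_coefficient S_indices)
  show "integrable cube2 (\<lambda>z. signed_sum S \<zeta> z * signed_sum S \<zeta>' z)"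
    unfolding eq using int by (rule Bochner_Integration.integrable_sum)
  have "(\<integral>z. signed_sum S \<zeta> z * signed_sum S \<zeta>' z \<partial>cube2)
      = (\<Sum>i\<in>S. \<zeta>' i * (\<integral>z. signed_sum S \<zeta> z * basis2 (fst i) (snd i) z \<partial>cube2))"
    unfolding eq using int by (subst Bochner_Integration.integral_sum) auto
  also have "\<dots> = (\<Sum>i\<in>S. \<zeta> i * \<zeta>' i)"
    by (rule sum.cong [OF refl]) (simp add: signed_sum_coefficient S_indices)
  finally show "(\<integral>z. signed_sum S \<zeta> z * signed_sum S \<zeta>' z \<partial>cube2) = (\<Sum>i\<in>S. \<zeta> i * \<zeta>' i)" .
qed

lemma integral_signed_sum:
  shows "integrable cube2 (signed_sum S \<zeta>)" and "(\<integral>z. signed_sum S \<zeta> z \<partial>cube2) = 0"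
proof -
  have eq: "basis2 (0, \<lambda>_. 0) (0, \<lambda>_. 0) z = 1" for z by (simp add: basis2_def)
  have "((0, \<lambda>_. 0), (0, \<lambda>_. 0)) \<notin> S" using nonconstant by auto
  then show "integrable cube2 (signed_sum S \<zeta>)" "(\<integral>z. signed_sum S \<zeta> z \<partial>cube2) = 0"
    using signed_sum_coefficient[OF zero_index zero_index, of \<zeta>] by (simp_all add: eq)
qed

lemma perturbed_inner_product:
  "(\<integral>z. perturbed \<delta> \<zeta> z * perturbed \<delta> \<zeta>' z \<partial>cube2) = 1 + \<delta>\<^sup>2 * (\<Sum>i\<in>S. \<zeta> i * \<zeta>' i)"
proof -
  interpret C: prob_space cube2 by (rule prob_space_cube2)
  have eq: "perturbed \<delta> \<zeta> z * perturbed \<delta> \<zeta>' z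
      = 1 + \<delta> * signed_sum S \<zeta> z + \<delta> * signed_sum S \<zeta>' z + \<delta>\<^sup>2 * (signed_sum S \<zeta> z * signed_sum S \<zeta>' z)" for z
    by (simp add: perturbed_def algebra_simps power2_eq_square)
  show ?thesis
    unfolding eq using integral_signed_sum signed_sum_inner_product C.prob_space by simp
qed

lemma integral_perturbed: "(\<integral>z. perturbed \<delta> \<zeta> z \<partial>cube2) = 1"
proof -
  interpret C: prob_space cube2 by (rule prob_space_cube2)
  show ?thesis
    unfolding perturbed_def using integral_signed_sum C.prob_space by simp
qed

lemma marg_X_perturbed: "marg_X (perturbed \<delta> \<zeta>) x = 1"
proof -
  interpret C: prob_space cube by (rule prob_space_cube)
  have int: "integrable cube (basis (snd i))" if "i \<in> S" for i
    by (rule integrable_cube_bounded[where B = "sqrt 2"]) (use S_indices[OF that] measurable_basis abs_basis_le in auto)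
  have "marg_X (perturbed \<delta> \<zeta>) x = (\<integral>y. 1 + (\<Sum>i\<in>S. (\<delta> * \<zeta> i * basis (fst i) x) * basis (snd i) y) \<partial>cube)"
    by (simp add: marg_X_def perturbed_def signed_sum_def basis2_def sum_distrib_left mult_ac)
  also have "\<dots> = 1 + (\<Sum>i\<in>S. (\<delta> * \<zeta> i * basis (fst i) x) * (\<integral>y. basis (snd i) y \<partial>cube))"
    using int C.prob_space
    by (subst Bochner_Integration.integral_add) (auto simp: Bochner_Integration.integral_sum intro!: Bochner_Integration.integrable_sum)
  also have "\<dots> = 1"
    using S_nonconstant by (simp add: integral_basis_nonconstant)
  finally show ?thesis .
qed

lemma marg_Y_perturbed: "marg_Y (perturbed \<delta> \<zeta>) y = 1"
proof -
  interpret C: prob_space cube by (rule prob_space_cube)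
  have int: "integrable cube (basis (fst i))" if "i \<in> S" for i
    by (rule integrable_cube_bounded[where B = "sqrt 2"]) (use S_indices[OF that] measurable_basis abs_basis_le in auto)
  have "marg_Y (perturbed \<delta> \<zeta>) y = (\<integral>x. 1 + (\<Sum>i\<in>S. (\<delta> * \<zeta> i * basis (snd i) y) * basis (fst i) x) \<partial>cube)"
    by (simp add: marg_Y_def perturbed_def signed_sum_def basis2_def sum_distrib_left mult_ac)
  also have "\<dots> = 1 + (\<Sum>i\<in>S. (\<delta> * \<zeta> i * basis (snd i) y) * (\<integral>x. basis (fst i) x \<partial>cube))"
    using int C.prob_space
    by (subst Bochner_Integration.integral_add) (auto simp: Bochner_Integration.integral_sum intro!: Bochner_Integration.integrable_sum)
  also have "\<dots> = 1"
    using S_nonconstant by (simp add: integral_basis_nonconstant)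
  finally show ?thesis .
qed

lemma dependence_perturbed:
  assumes "\<zeta> \<in> signs S"
  shows "dependence (perturbed \<delta> \<zeta>) = \<delta>\<^sup>2 * card S"
proof -
  have "dependence (perturbed \<delta> \<zeta>) = (\<integral>z. \<delta>\<^sup>2 * (signed_sum S \<zeta> z * signed_sum S \<zeta> z) \<partial>cube2)"
    unfolding dependence_def marg_X_perturbed marg_Y_perturbed
    by (simp add: perturbed_def power_mult_distrib power2_eq_square mult_ac)
  also have "\<dots> = \<delta>\<^sup>2 * (\<Sum>i\<in>S. (\<zeta> i)\<^sup>2)"
    by (simp add: signed_sum_inner_product power2_eq_square)
  also have "\<dots> = \<delta>\<^sup>2 * card S"
    using signs_square[OF assms] by simp
  finally show ?thesis .
qed

text \<open>
  The uniform part contributes the product of the two integrals of the basis functions, which is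
  what the marginal coefficients subtract again.
\<close>

lemma interaction_coefficient_perturbed:
  assumes jk: "j \<in> indices" "k \<in> indices"
  shows "coeff_XY (perturbed \<delta> \<zeta>) j k - coeff_X (perturbed \<delta> \<zeta>) j * coeff_Y (perturbed \<delta> \<zeta>) k
    = (if (j, k) \<in> S then \<delta> * \<zeta> (j, k) else 0)"
proof -
  have prod: "(\<integral>z. basis2 j k z \<partial>cube2) = (\<integral>x. basis j x \<partial>cube) * (\<integral>x. basis k x \<partial>cube)"
    unfolding basis2_def
    by (rule integral_cube2_product[where B = "sqrt 2"]) (use jk measurable_basis abs_basis_le in auto)
  have eq: "perturbed \<delta> \<zeta> z * basis2 j k z = basis2 j k z + \<delta> * (signed_sum S \<zeta> z * basis2 j k z)" for z
    by (simp add: perturbed_def algebra_simps)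
  have "integrable cube2 (basis2 j k)"
    by (rule integrable_cube2_bounded[where B = 2]) (use jk measurable_basis2 abs_basis2_le in auto)
  then have "coeff_XY (perturbed \<delta> \<zeta>) j k
      = (\<integral>z. basis2 j k z \<partial>cube2) + \<delta> * (\<integral>z. signed_sum S \<zeta> z * basis2 j k z \<partial>cube2)"
    unfolding coeff_XY_def eq using signed_sum_coefficient[OF jk] by simp
  then show ?thesis
    unfolding prod signed_sum_coefficient(2)[OF jk]
    by (simp add: coeff_X_def coeff_Y_def marg_X_perturbed marg_Y_perturbed)
qed

lemma sobolev_sum_perturbed:
  assumes \<zeta>: "\<zeta> \<in> signs S" and \<theta>: "\<And>j k. (j, k) \<in> S \<Longrightarrow> (\<theta> j k)\<^sup>2 \<le> ennreal w" and w: "0 \<le> w"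
  shows "sobolev_sum \<theta> (perturbed \<delta> \<zeta>) \<le> ennreal (\<delta>\<^sup>2 * card S * w)"
proof -
  have sub: "S \<subseteq> indices \<times> indices" using nonconstant by auto
  have "sobolev_sum \<theta> (perturbed \<delta> \<zeta>)
      = (\<Sum>\<^sub>\<infinity>(j, k)\<in>S. (\<theta> j k)\<^sup>2 * ennreal ((\<delta> * \<zeta> (j, k))\<^sup>2))"
    unfolding sobolev_sum_def
    by (rule infsum_cong_neutral) (use sub in \<open>auto simp: interaction_coefficient_perturbed split: if_splits\<close>)
  also have "\<dots> = (\<Sum>(j, k)\<in>S. (\<theta> j k)\<^sup>2 * ennreal ((\<delta> * \<zeta> (j, k))\<^sup>2))"
    by (rule infsum_finite[OF finite])
  also have "\<dots> \<le> (\<Sum>(j, k)\<in>S. ennreal (w * \<delta>\<^sup>2))"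
  proof (rule sum_mono)
    fix i assume i: "i \<in> S"
    obtain j k where jk: "i = (j, k)" by (cases i)
    have "(\<theta> j k)\<^sup>2 * ennreal ((\<delta> * \<zeta> (j, k))\<^sup>2) \<le> ennreal w * ennreal (\<delta>\<^sup>2)"
      using \<theta>[of j k] signs_square[OF \<zeta> i] i jk
      by (intro mult_mono) (auto simp: power_mult_distrib)
    also have "\<dots> = ennreal (w * \<delta>\<^sup>2)" using w by (simp add: ennreal_mult)
    finally show "(case i of (j, k) \<Rightarrow> (\<theta> j k)\<^sup>2 * ennreal ((\<delta> * \<zeta> (j, k))\<^sup>2))
        \<le> (case i of (j, k) \<Rightarrow> ennreal (w * \<delta>\<^sup>2))"
      by (simp add: jk)
  qed
  also have "\<dots> = ennreal (\<delta>\<^sup>2 * card S * w)"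
    using w by (simp add: ennreal_of_nat_eq_real_of_nat ennreal_mult [symmetric] mult_ac)
  finally show ?thesis .
qed

lemma measurable_perturbed: "perturbed \<delta> \<zeta> \<in> borel_measurable cube2"
  unfolding perturbed_def [abs_def] using measurable_signed_sum by measurable

lemma perturbed_in_alternatives:
  assumes \<zeta>: "\<zeta> \<in> signs S" and \<theta>: "\<And>j k. (j, k) \<in> S \<Longrightarrow> (\<theta> j k)\<^sup>2 \<le> ennreal w" and w: "0 \<le> w"
    and small: "\<And>z. z \<in> space cube2 \<Longrightarrow> \<bar>\<delta> * signed_sum S \<zeta> z\<bar> \<le> min 1 (A - 1)"
    and dep: "\<rho>\<^sup>2 \<le> \<delta>\<^sup>2 * card S" and smooth: "\<delta>\<^sup>2 * card S * w \<le> r\<^sup>2" and A: "1 \<le> A"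
  shows "perturbed \<delta> \<zeta> \<in> alternatives (\<theta>, r, A) \<rho>"
proof -
  have bounds: "0 \<le> perturbed \<delta> \<zeta> z" "perturbed \<delta> \<zeta> z \<le> A" if "z \<in> space cube2" for z
    using small[OF that] unfolding perturbed_def by linarith+
  have "integrable cube2 (\<lambda>z. (perturbed \<delta> \<zeta> z)\<^sup>2)"
    by (rule integrable_cube2_bounded[where B = "A\<^sup>2"])
       (use bounds measurable_perturbed in \<open>auto intro!: power_mono borel_measurable_power\<close>)
  then have "perturbed \<delta> \<zeta> \<in> densities"
    using measurable_perturbed bounds(1) integral_perturbed by (simp add: densities_def)
  moreover have "sobolev_sum \<theta> (perturbed \<delta> \<zeta>) \<le> ennreal (r\<^sup>2)"
    by (rule order_trans[OF sobolev_sum_perturbed[OF \<zeta> \<theta> w] ennreal_leI[OF smooth]])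
  moreover have "sup_norm cube2 (perturbed \<delta> \<zeta>) \<le> ennreal A"
    unfolding sup_norm_def by (rule SUP_least) (use bounds in \<open>auto intro!: ennreal_leI\<close>)
  moreover have "sup_norm cube (marg_X (perturbed \<delta> \<zeta>)) \<le> ennreal A" "sup_norm cube (marg_Y (perturbed \<delta> \<zeta>)) \<le> ennreal A"
    unfolding sup_norm_def marg_X_perturbed marg_Y_perturbed
    by (rule SUP_least, use A in \<open>auto intro!: ennreal_leI simp flip: ennreal_1\<close>)+
  ultimately show ?thesis
    using dep by (simp add: alternatives_def dependence_perturbed[OF \<zeta>])
qed

end

section \<open>Testing against a mixture\<close>

text \<open>
  Both measures agree on rectangles, where the indicator and the density factorise alike.
\<close>

lemma PiM_density:
  fixes f :: "'a \<Rightarrow> real"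
  assumes M: "prob_space M" and I: "finite I"
    and f [measurable]: "f \<in> borel_measurable M"
    and nonneg: "\<And>x. x \<in> space M \<Longrightarrow> 0 \<le> f x" and D: "prob_space (density M (\<lambda>x. ennreal (f x)))"
  shows "PiM I (\<lambda>_. density M (\<lambda>x. ennreal (f x)))
    = density (PiM I (\<lambda>_. M)) (\<lambda>\<omega>. ennreal (\<Prod>i\<in>I. f (\<omega> i)))"
proof -
  interpret M: product_prob_space "\<lambda>_. M" I by (intro product_prob_spaceI M)
  interpret D: product_prob_space "\<lambda>_. density M (\<lambda>x. ennreal (f x))" I by (intro product_prob_spaceI D)
  show ?thesis
  proof (rule D.PiM_eqI [symmetric])
    show "finite I" by (rule I)
    show "sets (density (PiM I (\<lambda>_. M)) (\<lambda>\<omega>. ennreal (\<Prod>i\<in>I. f (\<omega> i))))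
        = sets (PiM I (\<lambda>_. density M (\<lambda>x. ennreal (f x))))"
      by (simp cong: sets_PiM_cong)
    fix A assume A: "\<And>i. i \<in> I \<Longrightarrow> A i \<in> sets (density M (\<lambda>x. ennreal (f x)))"
    have [measurable]: "Pi\<^sub>E I A \<in> sets (PiM I (\<lambda>_. M))"
      using A I by (intro sets_PiM_I_finite) auto
    have A' [measurable]: "A i \<in> sets M" if "i \<in> I" for i using A[OF that] by simp
    have "emeasure (density (PiM I (\<lambda>_. M)) (\<lambda>\<omega>. ennreal (\<Prod>i\<in>I. f (\<omega> i)))) (Pi\<^sub>E I A)
        = (\<integral>\<^sup>+\<omega>. ennreal (\<Prod>i\<in>I. f (\<omega> i)) * indicator (Pi\<^sub>E I A) \<omega> \<partial>PiM I (\<lambda>_. M))"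
      by (subst emeasure_density) auto
    also have "\<dots> = (\<integral>\<^sup>+\<omega>. (\<Prod>i\<in>I. ennreal (f (\<omega> i)) * indicator (A i) (\<omega> i)) \<partial>PiM I (\<lambda>_. M))"
    proof (rule nn_integral_cong)
      fix \<omega> assume w: "\<omega> \<in> space (PiM I (\<lambda>_. M))"
      have 1: "ennreal (\<Prod>i\<in>I. f (\<omega> i)) = (\<Prod>i\<in>I. ennreal (f (\<omega> i)))"
        using w by (intro prod_ennreal [symmetric] nonneg) (auto simp: space_PiM)
      have 2: "indicator (Pi\<^sub>E I A) \<omega> = (\<Prod>i\<in>I. indicator (A i) (\<omega> i) :: ennreal)"
      proof (cases "\<forall>i\<in>I. \<omega> i \<in> A i")
        case True
        then show ?thesis using w by (auto simp: indicator_def space_PiM PiE_iff)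
      next
        case False
        then have "(\<Prod>i\<in>I. indicator (A i) (\<omega> i) :: ennreal) = 0"
          using I by (auto intro: prod_zero simp: indicator_def)
        then show ?thesis using False by (auto simp: indicator_def PiE_iff)
      qed
      show "ennreal (\<Prod>i\<in>I. f (\<omega> i)) * indicator (Pi\<^sub>E I A) \<omega>
          = (\<Prod>i\<in>I. ennreal (f (\<omega> i)) * indicator (A i) (\<omega> i))"
        unfolding 1 2 prod.distrib ..
    qed
    also have "\<dots> = (\<Prod>i\<in>I. \<integral>\<^sup>+x. ennreal (f x) * indicator (A i) x \<partial>M)"
      by (rule M.product_nn_integral_prod) (use I A' in auto)
    also have "\<dots> = (\<Prod>i\<in>I. emeasure (density M (\<lambda>x. ennreal (f x))) (A i))"
      by (intro prod.cong refl emeasure_density [symmetric]) (use A' in auto)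
    finally show "emeasure (density (PiM I (\<lambda>_. M)) (\<lambda>\<omega>. ennreal (\<Prod>i\<in>I. f (\<omega> i)))) (Pi\<^sub>E I A)
        = (\<Prod>i\<in>I. emeasure (density M (\<lambda>x. ennreal (f x))) (A i))" .
  qed
qed

lemma sample_expectation_density:
  fixes f :: "'a \<Rightarrow> real"
  assumes "prob_space M" "f \<in> borel_measurable M" "\<And>x. x \<in> space M \<Longrightarrow> 0 \<le> f x"
    and "prob_space (density M (\<lambda>x. ennreal (f x)))" and "\<phi> \<in> borel_measurable (PiM {..<n} (\<lambda>_. M))"
  shows "sample_expectation n (density M (\<lambda>x. ennreal (f x))) \<phi>
    = (\<integral>\<omega>. (\<Prod>i<n. f (\<omega> i)) * \<phi> \<omega> \<partial>PiM {..<n} (\<lambda>_. M))"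
proof -
  note [measurable] = assms(2,5)
  have "sample_expectation n (density M (\<lambda>x. ennreal (f x))) \<phi>
      = (\<integral>\<omega>. \<phi> \<omega> \<partial>density (PiM {..<n} (\<lambda>_. M)) (\<lambda>\<omega>. ennreal (\<Prod>i<n. f (\<omega> i))))"
    unfolding sample_expectation_def by (subst PiM_density) (use assms in auto)
  also have "\<dots> = (\<integral>\<omega>. (\<Prod>i<n. f (\<omega> i)) *\<^sub>R \<phi> \<omega> \<partial>PiM {..<n} (\<lambda>_. M))"
    by (rule integral_density) (auto intro!: AE_I2 prod_nonneg assms(3) simp: space_PiM)
  finally show ?thesis by simp
qed

lemma (in prob_space) expectation_abs_le_sqrt_second_moment:
  fixes X :: "'a \<Rightarrow> real"
  assumes "integrable M X" "integrable M (\<lambda>x. (X x)\<^sup>2)" "expectation (\<lambda>x. (X x)\<^sup>2) \<le> \<eta>\<^sup>2" "0 \<le> \<eta>"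
  shows "expectation (\<lambda>x. \<bar>X x\<bar>) \<le> \<eta>"
proof -
  have "0 \<le> variance (\<lambda>x. \<bar>X x\<bar>)" by simp
  also have "\<dots> = expectation (\<lambda>x. \<bar>X x\<bar>\<^sup>2) - (expectation (\<lambda>x. \<bar>X x\<bar>))\<^sup>2"
    by (rule variance_eq) (use assms in auto)
  finally have "(expectation (\<lambda>x. \<bar>X x\<bar>))\<^sup>2 \<le> \<eta>\<^sup>2"
    using assms(3) by simp
  then show ?thesis using assms(4) by (rule power2_le_imp_le)
qed

text \<open>
  Le Cam's bound. The double sum in the hypothesis is \<open>(card G)\<^sup>2\<close> times the second moment of the
  averaged likelihood ratio \<open>h\<close>, so \<open>h\<close> is at distance at most \<open>\<eta>\<close> from \<open>1\<close> in the mean. A test therefore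
  rejects under the mixture with a probability at most \<open>\<alpha> + \<eta>\<close>, and some member of the family does no
  better than the average.
\<close>

lemma mixture_type_II_error:
  fixes f :: "'g \<Rightarrow> 'a \<Rightarrow> real"
  assumes M: "prob_space M" and G: "finite G" "G \<noteq> {}"
    and f [measurable]: "\<And>g. g \<in> G \<Longrightarrow> f g \<in> borel_measurable M"
    and nonneg: "\<And>g x. g \<in> G \<Longrightarrow> x \<in> space M \<Longrightarrow> 0 \<le> f g x"
    and bound: "\<And>g x. g \<in> G \<Longrightarrow> x \<in> space M \<Longrightarrow> f g x \<le> B"
    and mass: "\<And>g. g \<in> G \<Longrightarrow> (\<integral>x. f g x \<partial>M) = 1"
    and chi2: "(\<Sum>g\<in>G. \<Sum>h\<in>G. (\<integral>x. f g x * f h x \<partial>M) ^ n) \<le> (1 + \<eta>\<^sup>2) * (real (card G))\<^sup>2"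
    and \<eta>: "0 \<le> \<eta>"
    and \<psi> [measurable]: "\<psi> \<in> borel_measurable (PiM {..<n} (\<lambda>_. M))"
    and \<psi>01: "\<And>\<omega>. \<omega> \<in> space (PiM {..<n} (\<lambda>_. M)) \<Longrightarrow> 0 \<le> \<psi> \<omega> \<and> \<psi> \<omega> \<le> 1"
    and level: "sample_expectation n M \<psi> \<le> \<alpha>"
  shows "\<exists>g\<in>G. sample_expectation n (density M (\<lambda>x. ennreal (f g x))) (\<lambda>\<omega>. 1 - \<psi> \<omega>) \<ge> 1 - \<alpha> - \<eta>"
proof -
  interpret M: prob_space M by (rule M)
  let ?P = "PiM {..<n} (\<lambda>_. M)"
  have P: "prob_space ?P" by (intro prob_space_PiM M)
  interpret P: prob_space ?P by (rule P)
  interpret pM: product_prob_space "\<lambda>_. M" "{..<n}" by (intro product_prob_spaceI M)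
  define L where "L g \<omega> = (\<Prod>i<n. f g (\<omega> i))" for g and \<omega> :: "nat \<Rightarrow> 'a"
  define h where "h \<omega> = (\<Sum>g\<in>G. L g \<omega>) / card G" for \<omega>
  have card: "0 < real (card G)" using G by (simp add: card_gt_0_iff)
  have f_int: "integrable M (f g)" if "g \<in> G" for g
    by (rule M.integrable_const_bound[where B = B]) (use nonneg bound that in auto)
  have ff_int: "integrable M (\<lambda>x. f g x * f g' x)" if "g \<in> G" "g' \<in> G" for g g'
    by (rule M.integrable_const_bound[where B = "B * B"])
       (use nonneg bound that in \<open>auto simp: abs_mult intro!: mult_mono order_trans[OF nonneg bound]\<close>)
  have L_meas [measurable]: "L g \<in> borel_measurable ?P" if "g \<in> G" for g
    unfolding L_def using that by measurable
  have L_int: "integrable ?P (L g)" if "g \<in> G" for g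
    unfolding L_def by (rule pM.product_integrable_prod) (use f_int that in auto)
  have LL_int: "integrable ?P (\<lambda>\<omega>. L g \<omega> * L g' \<omega>)" if "g \<in> G" "g' \<in> G" for g g'
    unfolding L_def prod.distrib [symmetric]
    by (rule pM.product_integrable_prod) (use ff_int that in auto)
  have L_mass: "(\<integral>\<omega>. L g \<omega> \<partial>?P) = 1" if "g \<in> G" for g
    unfolding L_def by (subst pM.product_integral_prod) (use f_int that mass in auto)
  have LL: "(\<integral>\<omega>. L g \<omega> * L g' \<omega> \<partial>?P) = (\<integral>x. f g x * f g' x \<partial>M) ^ n" if "g \<in> G" "g' \<in> G" for g g'
    unfolding L_def prod.distrib [symmetric]
    by (subst pM.product_integral_prod) (use ff_int that in auto)
  have h_int: "integrable ?P h"
    unfolding h_def by (intro integrable_divide_zero Bochner_Integration.integrable_sum) (use L_int in auto)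
  have h_mass: "(\<integral>\<omega>. h \<omega> \<partial>?P) = 1"
    unfolding h_def using G L_int L_mass card by (simp add: Bochner_Integration.integral_sum)
  have h2: "(h \<omega>)\<^sup>2 = (\<Sum>g\<in>G. \<Sum>g'\<in>G. L g \<omega> * L g' \<omega>) / (card G)\<^sup>2" for \<omega>
    unfolding h_def power_divide by (simp add: power2_eq_square sum_product)
  have h2_int: "integrable ?P (\<lambda>\<omega>. (h \<omega>)\<^sup>2)"
    unfolding h2 by (intro integrable_divide_zero Bochner_Integration.integrable_sum) (use LL_int in auto)
  have "(\<integral>\<omega>. (h \<omega>)\<^sup>2 \<partial>?P) = (\<Sum>g\<in>G. \<Sum>g'\<in>G. (\<integral>x. f g x * f g' x \<partial>M) ^ n) / (card G)\<^sup>2"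
    unfolding h2 using LL_int LL by (simp add: Bochner_Integration.integral_sum Bochner_Integration.integrable_sum)
  also have "\<dots> \<le> 1 + \<eta>\<^sup>2"
    using chi2 card by (simp add: divide_le_eq)
  finally have h2_le: "(\<integral>\<omega>. (h \<omega>)\<^sup>2 \<partial>?P) \<le> 1 + \<eta>\<^sup>2" .
  have sq: "(h \<omega> - 1)\<^sup>2 = (h \<omega>)\<^sup>2 - 2 * h \<omega> + 1" for \<omega>
    by (simp add: power2_eq_square algebra_simps)
  have dist: "(\<integral>\<omega>. \<bar>h \<omega> - 1\<bar> \<partial>?P) \<le> \<eta>"
  proof (rule prob_space.expectation_abs_le_sqrt_second_moment[OF P _ _ _ \<eta>])
    show "(\<integral>\<omega>. (h \<omega> - 1)\<^sup>2 \<partial>?P) \<le> \<eta>\<^sup>2"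
      unfolding sq using h2_int h_int h2_le h_mass P.prob_space by simp
  qed (use h_int h2_int in \<open>simp_all add: sq\<close>)
  have \<psi>_int: "integrable ?P \<psi>"
    by (rule P.integrable_const_bound[where B = 1]) (use \<psi>01 in auto)
  have h\<psi>_int: "integrable ?P (\<lambda>\<omega>. h \<omega> * (1 - \<psi> \<omega>))"
    by (rule Bochner_Integration.integrable_bound[OF h_int])
       (use h_int \<psi>01 in \<open>auto simp: abs_mult intro!: AE_I2 mult_left_le borel_measurable_integrable\<close>)
  have L\<psi>_int: "integrable ?P (\<lambda>\<omega>. L g \<omega> * (1 - \<psi> \<omega>))" if "g \<in> G" for g
    by (rule Bochner_Integration.integrable_bound[OF L_int[OF that]])
       (use L_int[OF that] \<psi>01 in \<open>auto simp: abs_mult intro!: AE_I2 mult_left_le borel_measurable_integrable\<close>)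
  define E where "E g = (\<integral>\<omega>. L g \<omega> * (1 - \<psi> \<omega>) \<partial>?P)" for g
  have "1 - \<alpha> - \<eta> \<le> (\<integral>\<omega>. 1 - \<psi> \<omega> \<partial>?P) - (\<integral>\<omega>. \<bar>h \<omega> - 1\<bar> \<partial>?P)"
    using level \<psi>_int dist P.prob_space by (simp add: sample_expectation_def)
  also have "\<dots> = (\<integral>\<omega>. (1 - \<psi> \<omega>) - \<bar>h \<omega> - 1\<bar> \<partial>?P)"
    using \<psi>_int h_int by simp
  also have "\<dots> \<le> (\<integral>\<omega>. h \<omega> * (1 - \<psi> \<omega>) \<partial>?P)"
  proof (rule integral_mono)
    fix \<omega> assume w: "\<omega> \<in> space ?P"
    have "\<bar>h \<omega> - 1\<bar> * (1 - \<psi> \<omega>) \<le> \<bar>h \<omega> - 1\<bar>"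
      using \<psi>01[OF w] by (intro mult_left_le) auto
    moreover have "- ((h \<omega> - 1) * (1 - \<psi> \<omega>)) \<le> \<bar>h \<omega> - 1\<bar> * (1 - \<psi> \<omega>)"
      unfolding mult_minus_left [symmetric] using \<psi>01[OF w] by (intro mult_right_mono) auto
    ultimately show "(1 - \<psi> \<omega>) - \<bar>h \<omega> - 1\<bar> \<le> h \<omega> * (1 - \<psi> \<omega>)"
      by (simp add: algebra_simps)
  qed (use \<psi>_int h_int h\<psi>_int in auto)
  also have "\<dots> = (\<integral>\<omega>. (\<Sum>g\<in>G. L g \<omega> * (1 - \<psi> \<omega>)) / card G \<partial>?P)"
    by (simp add: h_def sum_distrib_right)
  also have "\<dots> = (\<Sum>g\<in>G. E g) / card G"
    unfolding E_def using L\<psi>_int by (simp add: Bochner_Integration.integral_sum)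
  finally have avg: "(\<Sum>g\<in>G. 1 - \<alpha> - \<eta>) \<le> (\<Sum>g\<in>G. E g)"
    using card by (simp add: field_simps)
  have "\<exists>g\<in>G. 1 - \<alpha> - \<eta> \<le> E g"
  proof (rule ccontr)
    assume "\<not> ?thesis"
    then have "(\<Sum>g\<in>G. E g) < (\<Sum>g\<in>G. 1 - \<alpha> - \<eta>)"
      using G by (intro sum_strict_mono) auto
    then show False using avg by simp
  qed
  moreover have "sample_expectation n (density M (\<lambda>x. ennreal (f g x))) (\<lambda>\<omega>. 1 - \<psi> \<omega>) = E g"
    if "g \<in> G" for g
    unfolding E_def L_def
  proof (rule sample_expectation_density)
    have "emeasure (density M (\<lambda>x. ennreal (f g x))) (space M) = (\<integral>\<^sup>+x. ennreal (f g x) \<partial>M)"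
      using that by (simp add: emeasure_density cong: nn_integral_cong)
    also have "\<dots> = 1"
      using nn_integral_eq_integral[OF f_int[OF that]] mass[OF that] nonneg[OF that] by simp
    finally show "prob_space (density M (\<lambda>x. ennreal (f g x)))"
      by (intro prob_spaceI) simp
  qed (use M f nonneg that in auto)
  ultimately show ?thesis by auto
qed

section \<open>From a family of perturbations to the separation radius\<close>

lemma cube2_null_distribution: "cube2 \<in> null_distributions"
proof -
  interpret C: prob_space cube by (rule prob_space_cube)
  interpret P: pair_prob_space cube cube ..
  have fst: "distr (cube \<Otimes>\<^sub>M cube) cube fst = cube"
    by (rule C.distr_pair_fst)
  have snd: "distr (cube \<Otimes>\<^sub>M cube) cube snd = cube"
  proof (rule measure_eqI)
    fix A assume "A \<in> sets (distr (cube \<Otimes>\<^sub>M cube) cube snd)"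
    then have A: "A \<in> sets cube" by simp
    have "snd -` A \<inter> space (cube \<Otimes>\<^sub>M cube) = space cube \<times> A"
      using sets.sets_into_space[OF A] by (auto simp: space_pair_measure)
    then show "emeasure (distr (cube \<Otimes>\<^sub>M cube) cube snd) A = emeasure cube A"
      using A by (simp add: emeasure_distr C.emeasure_pair_measure_Times C.emeasure_space_1)
  qed simp
  have "prob_space.indep_var (cube \<Otimes>\<^sub>M cube) cube fst cube snd"
    unfolding P.indep_var_distribution_eq fst snd by (auto simp: distr_id2)
  then show ?thesis
    unfolding null_distributions_def cube2_def using P.prob_space_axioms by simp
qed

lemma sample_expectation_le_1:
  assumes P: "prob_space P" "sets P = sets cube2" and \<psi>: "\<psi> \<in> tests n"
  shows "sample_expectation n P \<psi> \<le> 1" and "sample_expectation n P (\<lambda>\<omega>. 1 - \<psi> \<omega>) \<le> 1"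
proof -
  interpret prob_space "PiM {..<n} (\<lambda>_. P)" by (intro prob_space_PiM P)
  have sets: "sets (PiM {..<n} (\<lambda>_. P)) = sets (PiM {..<n} (\<lambda>_. cube2))"
    by (rule sets_PiM_cong) (use P in auto)
  have meas: "\<psi> \<in> borel_measurable (PiM {..<n} (\<lambda>_. P))"
    using \<psi> by (simp add: tests_def cong: measurable_cong_sets[OF sets refl])
  have bounds: "0 \<le> \<psi> \<omega>" "\<psi> \<omega> \<le> 1" if "\<omega> \<in> space (PiM {..<n} (\<lambda>_. P))" for \<omega>
    using \<psi> that by (auto simp: tests_def sets_eq_imp_space_eq[OF sets])
  have int: "integrable (PiM {..<n} (\<lambda>_. P)) \<psi>"
    by (rule integrable_const_bound[where B = 1]) (use bounds meas in auto)
  show "sample_expectation n P \<psi> \<le> 1"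
    unfolding sample_expectation_def by (rule integral_le_const[OF int]) (use bounds in auto)
  show "sample_expectation n P (\<lambda>\<omega>. 1 - \<psi> \<omega>) \<le> 1"
    unfolding sample_expectation_def by (rule integral_le_const) (use int bounds in auto)
qed

lemma level_tests_null:
  assumes "\<psi> \<in> level_tests n \<alpha>"
  shows "sample_expectation n cube2 \<psi> \<le> \<alpha>"
proof -
  have "bdd_above ((\<lambda>P. sample_expectation n P \<psi>) ` null_distributions)"
    using assms sample_expectation_le_1 by (auto simp: level_tests_def null_distributions_def intro!: bdd_aboveI2[where M = 1])
  then have "sample_expectation n cube2 \<psi> \<le> (SUP P\<in>null_distributions. sample_expectation n P \<psi>)"
    using cube2_null_distribution by (intro cSUP_upper)
  then show ?thesis using assms by (simp add: level_tests_def)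
qed

lemma zero_level_test:
  assumes "0 \<le> \<alpha>"
  shows "(\<lambda>_. 0) \<in> level_tests n \<alpha>"
proof -
  have "null_distributions \<noteq> {}" using cube2_null_distribution by auto
  then show ?thesis
    using assms by (simp add: level_tests_def tests_def sample_expectation_def)
qed

lemma prob_space_densities:
  assumes "f \<in> densities"
  shows "prob_space (density cube2 (\<lambda>z. ennreal (f z)))"
proof -
  have f: "f \<in> borel_measurable cube2" "\<And>z. z \<in> space cube2 \<Longrightarrow> 0 \<le> f z" "(\<integral>z. f z \<partial>cube2) = 1"
    using assms by (auto simp: densities_def)
  have int: "integrable cube2 f"
    using f(3) not_integrable_integral_eq by fastforce
  note [measurable] = f(1)
  have "emeasure (density cube2 (\<lambda>z. ennreal (f z))) (space cube2) = (\<integral>\<^sup>+z. ennreal (f z) \<partial>cube2)"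
    by (simp add: emeasure_density cong: nn_integral_cong)
  also have "\<dots> = 1"
    using nn_integral_eq_integral[OF int] f by simp
  finally show ?thesis by (intro prob_spaceI) simp
qed

text \<open>
  The suprema and infima in the definition of the risk are those of the real numbers, so they have
  to be shown to be taken over bounded, nonempty sets.
\<close>

lemma minimax_risk_ge:
  assumes \<alpha>: "0 \<le> \<alpha>"
    and hard: "\<And>\<psi>. \<psi> \<in> level_tests n \<alpha> \<Longrightarrow> \<exists>f\<in>alternatives \<xi> \<rho>.
      b \<le> sample_expectation n (density cube2 (\<lambda>z. ennreal (f z))) (\<lambda>\<omega>. 1 - \<psi> \<omega>)"
  shows "\<alpha> + b \<le> minimax_risk n \<alpha> \<xi> \<rho>"
proof -
  let ?E = "\<lambda>\<psi> f. sample_expectation n (density cube2 (\<lambda>z. ennreal (f z))) (\<lambda>\<omega>. 1 - \<psi> \<omega>)"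
  have alt: "f \<in> densities" if "f \<in> alternatives \<xi> \<rho>" for f
    using that by (auto simp: alternatives_def split: prod.splits)
  have "b \<le> (INF \<psi>\<in>level_tests n \<alpha>. SUP f\<in>alternatives \<xi> \<rho>. ?E \<psi> f)"
  proof (rule cINF_greatest)
    show "level_tests n \<alpha> \<noteq> {}" using zero_level_test[OF \<alpha>] by auto
    fix \<psi> assume \<psi>: "\<psi> \<in> level_tests n \<alpha>"
    obtain f where f: "f \<in> alternatives \<xi> \<rho>" "b \<le> ?E \<psi> f" using hard[OF \<psi>] by blast
    have "bdd_above (?E \<psi> ` alternatives \<xi> \<rho>)"
      using \<psi> by (intro bdd_aboveI2[where M = 1] sample_expectation_le_1 prob_space_densities alt)
                (auto simp: level_tests_def)
    then have "?E \<psi> f \<le> (SUP f\<in>alternatives \<xi> \<rho>. ?E \<psi> f)" by (rule cSUP_upper[OF f(1)])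
    then show "b \<le> (SUP f\<in>alternatives \<xi> \<rho>. ?E \<psi> f)" using f(2) by linarith
  qed
  moreover have "alternatives \<xi> \<rho> \<noteq> {}" using hard[OF zero_level_test[OF \<alpha>]] by auto
  ultimately show ?thesis by (simp add: minimax_risk_def)
qed

text \<open>
  If \<open>\<rho>\<close> were below the separation of the perturbed densities, they would all be alternatives at
  distance \<open>\<rho>\<close>, and the mixture over the signs in \<open>G\<close> would force the risk above \<open>\<alpha> + \<beta>\<close>. Here \<open>p\<close> is the
  proportion of sign vectors that are lost because their perturbation is too large.
\<close>

lemma (in perturbation) separation_radius_ge:
  fixes \<delta> w r A p \<eta> \<alpha> \<beta> :: real
  assumes \<theta>: "\<And>j k. (j, k) \<in> S \<Longrightarrow> (\<theta> j k)\<^sup>2 \<le> ennreal w" "0 \<le> w" and smooth: "\<delta>\<^sup>2 * card S * w \<le> r\<^sup>2"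
    and A: "1 \<le> A" and G: "G \<subseteq> signs S"
    and small: "\<And>\<zeta> z. \<zeta> \<in> G \<Longrightarrow> z \<in> space cube2 \<Longrightarrow> \<bar>\<delta> * signed_sum S \<zeta> z\<bar> \<le> min 1 (A - 1)"
    and many: "(1 - p) * 2 ^ card S \<le> card G" "p < 1"
    and chi2: "exp (card S * (n * \<delta>\<^sup>2)\<^sup>2 / 2) \<le> (1 + \<eta>\<^sup>2) * (1 - p)\<^sup>2"
    and \<eta>: "0 \<le> \<eta>" "\<beta> < 1 - \<alpha> - \<eta>" and \<alpha>: "0 \<le> \<alpha>"
  shows "ereal (sqrt (\<delta>\<^sup>2 * card S)) \<le> separation_radius n \<alpha> \<beta> (\<theta>, r, A)"
  unfolding separation_radius_def
proof (rule INF_greatest)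
  fix \<rho> assume "\<rho> \<in> {\<rho>. 0 < \<rho> \<and> minimax_risk n \<alpha> (\<theta>, r, A) \<rho> \<le> \<alpha> + \<beta>}"
  then have \<rho>: "0 < \<rho>" "minimax_risk n \<alpha> (\<theta>, r, A) \<rho> \<le> \<alpha> + \<beta>" by auto
  have G': "finite G" "G \<noteq> {}"
  proof -
    show "finite G" using G finite_signs[OF finite] by (rule finite_subset)
    have "0 < (1 - p) * 2 ^ card S" using many(2) by simp
    then show "G \<noteq> {}" using many(1) by auto
  qed
  have "sqrt (\<delta>\<^sup>2 * card S) \<le> \<rho>"
  proof (rule ccontr)
    assume "\<not> sqrt (\<delta>\<^sup>2 * card S) \<le> \<rho>"
    then have "\<rho>\<^sup>2 \<le> (sqrt (\<delta>\<^sup>2 * card S))\<^sup>2" using \<rho> by (intro power_mono) auto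
    then have dep: "\<rho>\<^sup>2 \<le> \<delta>\<^sup>2 * card S" by simp
    have alt: "perturbed \<delta> \<zeta> \<in> alternatives (\<theta>, r, A) \<rho>" if "\<zeta> \<in> G" for \<zeta>
      using that G by (intro perturbed_in_alternatives[OF _ \<theta> small dep smooth A]) auto
    have dens: "0 \<le> perturbed \<delta> \<zeta> z" "perturbed \<delta> \<zeta> z \<le> A" if "\<zeta> \<in> G" "z \<in> space cube2" for \<zeta> z
      using small[OF that] unfolding perturbed_def by linarith+
    have "(\<Sum>\<zeta>\<in>G. \<Sum>\<zeta>'\<in>G. (\<integral>z. perturbed \<delta> \<zeta> z * perturbed \<delta> \<zeta>' z \<partial>cube2) ^ n)
        = (\<Sum>\<zeta>\<in>G. \<Sum>\<zeta>'\<in>G. (1 + \<delta>\<^sup>2 * (\<Sum>i\<in>S. \<zeta> i * \<zeta>' i)) ^ n)"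
      by (simp add: perturbed_inner_product)
    also have "\<dots> \<le> (2 ^ card S)\<^sup>2 * exp (card S * (n * \<delta>\<^sup>2)\<^sup>2 / 2)"
    proof (rule sum_signs_power_le[OF finite G])
      fix \<zeta> \<zeta>' assume "\<zeta> \<in> G" "\<zeta>' \<in> G"
      then have "0 \<le> (\<integral>z. perturbed \<delta> \<zeta> z * perturbed \<delta> \<zeta>' z \<partial>cube2)"
        by (intro integral_nonneg_AE AE_I2 mult_nonneg_nonneg dens)
      then show "0 \<le> 1 + \<delta>\<^sup>2 * (\<Sum>i\<in>S. \<zeta> i * \<zeta>' i)" by (simp add: perturbed_inner_product)
    qed
    also have "\<dots> \<le> (2 ^ card S)\<^sup>2 * ((1 + \<eta>\<^sup>2) * (1 - p)\<^sup>2)"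
      by (intro mult_left_mono chi2) simp
    also have "\<dots> = (1 + \<eta>\<^sup>2) * ((1 - p) * 2 ^ card S)\<^sup>2"
      by (simp add: power_mult_distrib)
    also have "\<dots> \<le> (1 + \<eta>\<^sup>2) * (real (card G))\<^sup>2"
      using many by (intro mult_left_mono power_mono) auto
    finally have X: "(\<Sum>\<zeta>\<in>G. \<Sum>\<zeta>'\<in>G. (\<integral>z. perturbed \<delta> \<zeta> z * perturbed \<delta> \<zeta>' z \<partial>cube2) ^ n)
        \<le> (1 + \<eta>\<^sup>2) * (real (card G))\<^sup>2" .
    have "\<alpha> + (1 - \<alpha> - \<eta>) \<le> minimax_risk n \<alpha> (\<theta>, r, A) \<rho>"
    proof (rule minimax_risk_ge[OF \<alpha>])
      fix \<psi> assume \<psi>: "\<psi> \<in> level_tests n \<alpha>"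
      have "\<exists>\<zeta>\<in>G. sample_expectation n (density cube2 (\<lambda>z. ennreal (perturbed \<delta> \<zeta> z))) (\<lambda>\<omega>. 1 - \<psi> \<omega>) \<ge> 1 - \<alpha> - \<eta>"
        by (rule mixture_type_II_error[OF prob_space_cube2 G' measurable_perturbed dens integral_perturbed X \<eta>(1)])
           (use \<psi> level_tests_null[OF \<psi>] in \<open>auto simp: level_tests_def tests_def\<close>)
      then show "\<exists>f\<in>alternatives (\<theta>, r, A) \<rho>.
          1 - \<alpha> - \<eta> \<le> sample_expectation n (density cube2 (\<lambda>z. ennreal (f z))) (\<lambda>\<omega>. 1 - \<psi> \<omega>)"
        using alt by blast
    qed
    then show False using \<rho>(2) \<eta>(2) by linarith
  qed
  then show "ereal (sqrt (\<delta>\<^sup>2 * card S)) \<le> ereal \<rho>" by simp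
qed

section \<open>Counting frequencies\<close>

text \<open>
  The increments of \<open>ln (1 + k)\<close>. Summation by parts turns \<open>c0\<close> into the sum of these increments
  divided by \<open>sqrt (k + 1)\<close>.
\<close>

definition c0_increment :: "nat \<Rightarrow> real" where
  "c0_increment k = ln (1 + real (Suc k)) - ln (1 + real k)"

lemma c0_increment_nonneg: "0 \<le> c0_increment k"
  by (simp add: c0_increment_def)

lemma sum_c0_increment: "(\<Sum>k<K. c0_increment k) = ln (1 + real K)"
  by (induction K) (simp_all add: c0_increment_def)

lemma c0_increment_le: "c0_increment k \<le> 1 / real (Suc k)"
proof -
  have "c0_increment k = ln ((1 + real (Suc k)) / (1 + real k))"
    unfolding c0_increment_def by (subst ln_div) auto
  also have "(1 + real (Suc k)) / (1 + real k) = 1 + 1 / real (Suc k)"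
    by (simp add: field_simps)
  finally have "c0_increment k = ln (1 + 1 / real (Suc k))" .
  also have "\<dots> \<le> 1 / real (Suc k)"
    by (rule ln_add_one_self_le_self) simp
  finally show ?thesis .
qed

text \<open>
  Partial sums of \<open>D\<close> and of the series \<open>T\<close> that defines \<open>c0\<close> differ by a boundary term of summation by parts that
  tends to zero, so \<open>D\<close> sums to \<open>c0\<close> as well; its terms are nonnegative, so its partial sums stay below
  the limit.
\<close>

lemma sum_c0_increment_le_c0: "(\<Sum>k<K. c0_increment k / sqrt (real (Suc k))) \<le> c0"
proof -
  define D where "D k = c0_increment k / sqrt (real (Suc k))" for k
  define T where "T l = (1 / sqrt (real (Suc l)) - 1 / sqrt (real (Suc l) + 1)) * ln (1 + real (Suc l))" for l
  have D_nonneg: "0 \<le> D k" for k by (simp add: D_def c0_increment_nonneg)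
  have abel: "(\<Sum>k<K. D k) = (\<Sum>k<K. T k) + ln (1 + real K) / sqrt (real K + 1)" for K
  proof (induction K)
    case (Suc K)
    have "D K = T K + ln (1 + real (Suc K)) / sqrt (real (Suc K) + 1) - ln (1 + real K) / sqrt (real K + 1)"
      unfolding D_def T_def c0_increment_def divide_inverse of_nat_Suc by (simp only: algebra_simps)
    then show ?case using Suc by simp
  qed simp
  have "summable (\<lambda>k. real (Suc k) powr (- (3/2)))"
    using summable_real_powr_iff[of "- (3/2)"] by (subst summable_Suc_iff) simp
  then have D_summable: "summable D"
  proof (rule summable_comparison_test'[where N = 0])
    fix k
    have "D k \<le> 1 / real (Suc k) / sqrt (real (Suc k))"
      unfolding D_def by (intro divide_right_mono c0_increment_le) simp
    also have "\<dots> = real (Suc k) powr (- (3/2))"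
    proof -
      have "real (Suc k) powr (- (3/2)) = inverse (real (Suc k) powr (1 + 1/2))"
        by (simp only: powr_minus) simp
      also have "\<dots> = inverse (real (Suc k) * sqrt (real (Suc k)))"
        unfolding powr_add by (simp add: powr_half_sqrt)
      finally show ?thesis by (simp only: divide_divide_eq_left inverse_eq_divide)
    qed
    finally show "norm (D k) \<le> real (Suc k) powr (- (3/2))"
      using D_nonneg[of k] by simp
  qed
  have "(\<lambda>K. ln (1 + real K) / sqrt (real K + 1)) \<longlonglongrightarrow> 0"
    by real_asymp
  then have "(\<lambda>K. (\<Sum>k<K. D k) - ln (1 + real K) / sqrt (real K + 1)) \<longlonglongrightarrow> suminf D - 0"
    by (intro tendsto_diff summable_LIMSEQ D_summable)
  then have "(\<lambda>K. \<Sum>k<K. T k) \<longlonglongrightarrow> suminf D"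
    unfolding abel by simp
  then have "suminf T = suminf D"
    by (intro sums_unique [symmetric]) (simp add: sums_def)
  then have "c0 = suminf D"
    by (simp add: c0_def T_def [abs_def])
  moreover have "(\<Sum>k<K. D k) \<le> suminf D"
    by (rule sum_le_suminf[OF D_summable]) (use D_nonneg in auto)
  ultimately show ?thesis by (simp add: D_def)
qed

lemma c0_pos: "0 < c0"
proof -
  have "0 < (\<Sum>k<Suc 0. c0_increment k / sqrt (real (Suc k)))"
    by (simp add: c0_increment_def)
  also have "\<dots> \<le> c0" by (rule sum_c0_increment_le_c0)
  finally show ?thesis .
qed

lemma floor_div_square_eq_0:
  assumes "0 \<le> t" "nat \<lfloor>t\<rfloor> \<le> l"
  shows "\<lfloor>t / (real (Suc l))\<^sup>2\<rfloor> = 0"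
proof -
  have "t < real (Suc l)" using assms by linarith
  also have "real (Suc l) \<le> (real (Suc l))\<^sup>2"
    by (simp add: power2_eq_square)
  finally show ?thesis using assms(1) by (simp add: floor_eq_iff)
qed

lemma M_fun_eq_sum:
  assumes "0 \<le> t"
  shows "1 + M_fun t = exp (\<Sum>l<nat \<lfloor>t\<rfloor>. ln (1 + real_of_int \<lfloor>t / (real (Suc l))\<^sup>2\<rfloor>))"
proof -
  have "(\<Sum>l. ln (1 + real_of_int \<lfloor>t / (real (Suc l))\<^sup>2\<rfloor>))
      = (\<Sum>l<nat \<lfloor>t\<rfloor>. ln (1 + real_of_int \<lfloor>t / (real (Suc l))\<^sup>2\<rfloor>))"
    by (rule suminf_finite) (use floor_div_square_eq_0[OF assms] in auto)
  then show ?thesis by (simp add: M_fun_def)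
qed

text \<open>
  Write \<open>ln (1 + \<lfloor>t / \<ell>\<^sup>2\<rfloor>)\<close> as the sum of the increments with index \<open>k < \<lfloor>t / \<ell>\<^sup>2\<rfloor>\<close>
  and exchange the two sums: for each \<open>k\<close> at most \<open>sqrt (t / (k + 1))\<close> values of \<open>\<ell>\<close> occur.
\<close>

lemma M_fun_le:
  assumes t: "0 \<le> t"
  shows "1 + M_fun t \<le> exp (c0 * sqrt t)"
proof -
  define K where "K = nat \<lfloor>t\<rfloor>"
  have "(\<Sum>l<K. ln (1 + real_of_int \<lfloor>t / (real (Suc l))\<^sup>2\<rfloor>))
      = (\<Sum>l<K. \<Sum>k<K. if real (Suc k) * (real (Suc l))\<^sup>2 \<le> t then c0_increment k else 0)"
  proof (rule sum.cong [OF refl])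
    fix l
    define q where "q = nat \<lfloor>t / (real (Suc l))\<^sup>2\<rfloor>"
    have sq: "1 \<le> (real (Suc l))\<^sup>2" by (rule one_le_power) simp
    have "t / (real (Suc l))\<^sup>2 \<le> t" using sq t by (simp add: divide_le_eq mult_le_cancel_left1)
    then have "q \<le> K" unfolding q_def K_def by (intro nat_mono floor_mono)
    have "real (Suc k) * (real (Suc l))\<^sup>2 \<le> t \<longleftrightarrow> k < q" for k
    proof -
      have "real (Suc k) * (real (Suc l))\<^sup>2 \<le> t \<longleftrightarrow> real (Suc k) \<le> t / (real (Suc l))\<^sup>2"
        by (simp add: pos_le_divide_eq)
      also have "\<dots> \<longleftrightarrow> k < q"
        unfolding q_def using le_floor_iff[of "int (Suc k)" "t / (real (Suc l))\<^sup>2"] by auto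
      finally show ?thesis .
    qed
    then have "(\<Sum>k<K. if real (Suc k) * (real (Suc l))\<^sup>2 \<le> t then c0_increment k else 0)
        = (\<Sum>k<K. if k < q then c0_increment k else 0)"
      by simp
    also have "\<dots> = (\<Sum>k<q. c0_increment k)"
      by (rule sum.mono_neutral_cong_right) (use \<open>q \<le> K\<close> in auto)
    also have "\<dots> = ln (1 + real q)" by (rule sum_c0_increment)
    also have "real q = real_of_int \<lfloor>t / (real (Suc l))\<^sup>2\<rfloor>"
      unfolding q_def using t by simp
    finally show "ln (1 + real_of_int \<lfloor>t / (real (Suc l))\<^sup>2\<rfloor>)
        = (\<Sum>k<K. if real (Suc k) * (real (Suc l))\<^sup>2 \<le> t then c0_increment k else 0)" ..
  qed
  also have "\<dots> = (\<Sum>k<K. \<Sum>l<K. if real (Suc k) * (real (Suc l))\<^sup>2 \<le> t then c0_increment k else 0)"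
    by (rule sum.swap)
  also have "\<dots> \<le> (\<Sum>k<K. sqrt t * (c0_increment k / sqrt (real (Suc k))))"
  proof (rule sum_mono)
    fix k
    define y where "y = sqrt (t / real (Suc k))"
    have y: "0 \<le> y" using t by (simp add: y_def)
    have "{l. l < K \<and> real (Suc k) * (real (Suc l))\<^sup>2 \<le> t} \<subseteq> {..<nat \<lfloor>y\<rfloor>}"
    proof
      fix l assume "l \<in> {l. l < K \<and> real (Suc k) * (real (Suc l))\<^sup>2 \<le> t}"
      then have "(real (Suc l))\<^sup>2 \<le> t / real (Suc k)" by (simp add: field_simps)
      then have "real (Suc l) \<le> y" unfolding y_def by (rule real_le_rsqrt)
      then show "l \<in> {..<nat \<lfloor>y\<rfloor>}" using le_floor_iff[of "int (Suc l)" y] by auto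
    qed
    then have "card {l. l < K \<and> real (Suc k) * (real (Suc l))\<^sup>2 \<le> t} \<le> nat \<lfloor>y\<rfloor>"
      using card_mono[of "{..<nat \<lfloor>y\<rfloor>}"] by simp
    then have card: "real (card {l. l < K \<and> real (Suc k) * (real (Suc l))\<^sup>2 \<le> t}) \<le> y"
      using y by linarith
    have "(\<Sum>l<K. if real (Suc k) * (real (Suc l))\<^sup>2 \<le> t then c0_increment k else 0)
        = card {l. l < K \<and> real (Suc k) * (real (Suc l))\<^sup>2 \<le> t} * c0_increment k"
      by (subst sum.inter_filter [symmetric]) (auto simp: lessThan_def)
    also have "\<dots> \<le> y * c0_increment k"
      using card by (intro mult_right_mono c0_increment_nonneg)
    finally show "(\<Sum>l<K. if real (Suc k) * (real (Suc l))\<^sup>2 \<le> t then c0_increment k else 0)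
        \<le> sqrt t * (c0_increment k / sqrt (real (Suc k)))"
      by (simp add: y_def real_sqrt_divide)
  qed
  also have "\<dots> \<le> sqrt t * c0"
    unfolding sum_distrib_left [symmetric] using t
    by (intro mult_left_mono sum_c0_increment_le_c0) simp
  finally show ?thesis
    unfolding M_fun_eq_sum[OF t] K_def by (simp add: mult.commute)
qed

text \<open>
  The multi-indices of size at most \<open>t\<close>, without the detour through a maximum.
\<close>

definition frequencies :: "real \<Rightarrow> (nat \<Rightarrow> nat) set" where
  "frequencies t = {m. \<forall>l. real ((Suc l)\<^sup>2 * m l) \<le> t}"

lemma frequencies_zero_beyond:
  assumes m: "m \<in> frequencies t" and t: "t \<le> (real D)\<^sup>2" and l: "D \<le> l"
  shows "m l = 0"
proof (rule ccontr)
  assume "m l \<noteq> 0"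
  then have "(Suc l)\<^sup>2 * 1 \<le> (Suc l)\<^sup>2 * m l" by (intro mult_le_mono2) simp
  then have "real ((Suc l)\<^sup>2) \<le> real ((Suc l)\<^sup>2 * m l)" unfolding of_nat_le_iff by simp
  also have "\<dots> \<le> t" using m by (auto simp: frequencies_def)
  also have "\<dots> \<le> (real D)\<^sup>2" by (rule t)
  finally have "real (Suc l) \<le> real D" by (simp add: power2_le_iff_abs_le)
  then show False using l by simp
qed

lemma frequencies_le:
  assumes "m \<in> frequencies t"
  shows "real (m l) \<le> t"
proof -
  have "m l \<le> (Suc l)\<^sup>2 * m l" by simp
  then have "real (m l) \<le> real ((Suc l)\<^sup>2 * m l)" by (simp only: of_nat_le_iff)
  also have "\<dots> \<le> t" using assms by (auto simp: frequencies_def)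
  finally show ?thesis .
qed

lemma frequencies_multi_indices: "frequencies t \<subseteq> multi_indices"
proof
  fix m assume m: "m \<in> frequencies t"
  obtain D where D: "max 1 t \<le> real D" using real_arch_simple by blast
  have "t \<le> (real D)\<^sup>2"
  proof -
    have "t \<le> real D * 1" using D by simp
    also have "\<dots> \<le> real D * real D" using D by (intro mult_left_mono) auto
    finally show ?thesis by (simp add: power2_eq_square)
  qed
  then have "{l. m l \<noteq> 0} \<subseteq> {..<D}"
    using frequencies_zero_beyond[OF m, of D] by (intro subsetI) (metis mem_Collect_eq lessThan_iff leI)
  then show "m \<in> multi_indices"
    unfolding multi_indices_def by (simp add: finite_subset)
qed

lemma frequencies_eq_PiE_dflt:
  assumes "0 \<le> t"
  shows "frequencies t = PiE_dflt {..<nat \<lfloor>t\<rfloor>} 0 (\<lambda>l. {..nat \<lfloor>t / (real (Suc l))\<^sup>2\<rfloor>})"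
proof -
  have iff: "real ((Suc l)\<^sup>2 * q) \<le> t \<longleftrightarrow> q \<le> nat \<lfloor>t / (real (Suc l))\<^sup>2\<rfloor>" for l q
  proof -
    have "real ((Suc l)\<^sup>2 * q) \<le> t \<longleftrightarrow> real q \<le> t / (real (Suc l))\<^sup>2"
      by (simp add: pos_le_divide_eq mult.commute)
    also have "\<dots> \<longleftrightarrow> q \<le> nat \<lfloor>t / (real (Suc l))\<^sup>2\<rfloor>"
      using le_floor_iff[of "int q" "t / (real (Suc l))\<^sup>2"] assms by (auto simp: nat_le_iff le_nat_iff)
    finally show ?thesis .
  qed
  show ?thesis
    unfolding frequencies_def PiE_dflt_def iff
    using floor_div_square_eq_0[OF assms] by (auto simp: not_less) (metis le_zero_eq nat_zero_as_int not_le)+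
qed

lemma finite_frequencies: "0 \<le> t \<Longrightarrow> finite (frequencies t)"
  by (simp add: frequencies_eq_PiE_dflt finite_PiE_dflt)

text \<open>
  This is what \<open>M_fun\<close> counts: the entry with index \<open>l\<close> ranges over \<open>{0..\<lfloor>t / (l + 1)\<^sup>2\<rfloor>}\<close>,
  independently of the others.
\<close>

lemma card_frequencies:
  assumes "0 \<le> t"
  shows "real (card (frequencies t)) = 1 + M_fun t"
proof -
  have "real (card (frequencies t)) = (\<Prod>l<nat \<lfloor>t\<rfloor>. 1 + real_of_int \<lfloor>t / (real (Suc l))\<^sup>2\<rfloor>)"
    unfolding frequencies_eq_PiE_dflt[OF assms] using assms by (simp add: card_PiE_dflt add.commute)
  also have "\<dots> = exp (\<Sum>l<nat \<lfloor>t\<rfloor>. ln (1 + real_of_int \<lfloor>t / (real (Suc l))\<^sup>2\<rfloor>))"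
    using assms by (simp add: exp_sum add_pos_nonneg)
  finally show ?thesis by (simp add: M_fun_eq_sum[OF assms])
qed

lemma idx_size_le_iff:
  assumes "m \<in> multi_indices"
  shows "real (idx_size (a, m)) \<le> t \<longleftrightarrow> m \<in> frequencies t"
proof -
  have "range (\<lambda>l. (Suc l)\<^sup>2 * m l) \<subseteq> insert 0 ((\<lambda>l. (Suc l)\<^sup>2 * m l) ` {l. m l \<noteq> 0})"
    by auto
  then have fin: "finite (range (\<lambda>l. (Suc l)\<^sup>2 * m l))"
    using assms by (auto simp: multi_indices_def intro: finite_subset)
  have "real (idx_size (a, m)) \<le> t \<longleftrightarrow> (\<forall>y\<in>range (\<lambda>l. (Suc l)\<^sup>2 * m l). real y \<le> t)"
  proof
    assume "real (idx_size (a, m)) \<le> t"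
    moreover have "real y \<le> real (idx_size (a, m))" if "y \<in> range (\<lambda>l. (Suc l)\<^sup>2 * m l)" for y
      unfolding idx_size_def of_nat_le_iff using fin that by (intro Max_ge) auto
    ultimately show "\<forall>y\<in>range (\<lambda>l. (Suc l)\<^sup>2 * m l). real y \<le> t" by (meson order_trans)
  next
    assume *: "\<forall>y\<in>range (\<lambda>l. (Suc l)\<^sup>2 * m l). real y \<le> t"
    have "idx_size (a, m) \<in> range (\<lambda>l. (Suc l)\<^sup>2 * m l)"
      unfolding idx_size_def using Max_in[OF fin] by simp
    then show "real (idx_size (a, m)) \<le> t" using * by blast
  qed
  then show ?thesis by (auto simp: frequencies_def)
qed

lemma frequencies_0: "frequencies 0 = {\<lambda>_. 0}"
  unfolding frequencies_def of_nat_le_0_iff by auto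

definition frequency_indices :: "real \<Rightarrow> (nat \<times> (nat \<Rightarrow> nat)) set" where
  "frequency_indices t = {0, 1} \<times> (frequencies t - {\<lambda>_. 0})"

lemma frequency_indices_subset: "frequency_indices t \<subseteq> indices"
  using frequencies_multi_indices by (auto simp: frequency_indices_def indices_def)

lemma card_frequency_indices:
  assumes "0 \<le> t"
  shows "real (card (frequency_indices t)) = 2 * M_fun t"
proof -
  have 0: "(\<lambda>_. 0) \<in> frequencies t" using assms by (simp add: frequencies_def)
  then have "1 \<le> card (frequencies t)"
    using finite_frequencies[OF assms] by (metis One_nat_def Suc_leI card_gt_0_iff empty_iff)
  then show ?thesis
    using 0 finite_frequencies[OF assms] card_frequencies[OF assms]
    by (simp add: frequency_indices_def card_cartesian_product card_Diff_singleton of_nat_diff)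
qed

lemma idx_size_frequency_indices:
  assumes "j \<in> frequency_indices t"
  shows "real (idx_size j) \<le> t" "idx_size j \<noteq> 0"
proof -
  obtain a m where j: "j = (a, m)" "m \<in> frequencies t" "m \<noteq> (\<lambda>_. 0)"
    using assms by (auto simp: frequency_indices_def)
  have m: "m \<in> multi_indices" using j frequencies_multi_indices by auto
  show "real (idx_size j) \<le> t" using idx_size_le_iff[OF m] j by simp
  have "\<not> real (idx_size j) \<le> 0"
    using idx_size_le_iff[OF m, of a 0] j by (simp add: frequencies_0)
  then show "idx_size j \<noteq> 0" by auto
qed

section \<open>The supremum of a random trigonometric sum\<close>

lemma abs_cos_diff_le: "\<bar>cos u - cos v\<bar> \<le> \<bar>u - v\<bar>" for u v :: real
proof -
  have "\<bar>cos u - cos v\<bar> = 2 * (\<bar>sin ((u + v) / 2)\<bar> * \<bar>sin ((v - u) / 2)\<bar>)"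
    unfolding cos_diff_cos by (simp add: abs_mult)
  also have "\<dots> \<le> 2 * (1 * \<bar>(v - u) / 2\<bar>)"
    by (intro mult_left_mono mult_mono abs_sin_x_le_abs_x abs_sin_le_one) auto
  finally show ?thesis by (simp add: abs_minus_commute)
qed

text \<open>
  Only the first \<open>D\<close> coordinates matter, and each of them has a frequency of at most \<open>D\<^sup>2\<close>.
\<close>

lemma basis_Lipschitz:
  assumes j: "j \<in> frequency_indices t" and t: "t \<le> (real D)\<^sup>2"
    and xy: "\<And>l. l < D \<Longrightarrow> \<bar>x l - y l\<bar> \<le> h"
  shows "\<bar>basis j x - basis j y\<bar> \<le> sqrt 2 * (2 * pi * real D ^ 3 * h)"
proof -
  obtain a m where jm: "j = (a, m)" "m \<in> frequencies t" "m \<noteq> (\<lambda>_. 0)"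
    using j by (auto simp: frequency_indices_def)
  have zero: "\<And>l. D \<le> l \<Longrightarrow> m l = 0" by (rule frequencies_zero_beyond[OF jm(2) t])
  have m_le: "real (m l) \<le> (real D)\<^sup>2" for l
    using frequencies_le[OF jm(2)] t by (rule order_trans)
  have b: "basis (a, m) v = sqrt 2 * cos (2 * pi * (\<Sum>l<D. m l * v l) + a * pi / 2)" for v :: "nat \<Rightarrow> real"
    by (rule basis_eq_cos[OF zero jm(3)])
  have "\<bar>basis j x - basis j y\<bar>
      = sqrt 2 * \<bar>cos (2 * pi * (\<Sum>l<D. m l * x l) + a * pi / 2) - cos (2 * pi * (\<Sum>l<D. m l * y l) + a * pi / 2)\<bar>"
    unfolding jm(1) b right_diff_distrib [symmetric] abs_mult by simp
  also have "\<dots> \<le> sqrt 2 * \<bar>2 * pi * (\<Sum>l<D. m l * x l) - 2 * pi * (\<Sum>l<D. m l * y l)\<bar>"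
    by (intro mult_left_mono order_trans[OF abs_cos_diff_le]) auto
  also have "2 * pi * (\<Sum>l<D. m l * x l) - 2 * pi * (\<Sum>l<D. m l * y l) = 2 * pi * (\<Sum>l<D. m l * (x l - y l))"
    by (simp add: right_diff_distrib sum_subtractf)
  also have "\<bar>2 * pi * (\<Sum>l<D. m l * (x l - y l))\<bar> \<le> 2 * pi * (\<Sum>l<D. \<bar>m l * (x l - y l)\<bar>)"
    unfolding abs_mult [of "2 * pi"] by (simp add: sum_abs)
  also have "\<dots> \<le> 2 * pi * (\<Sum>l<D. (real D)\<^sup>2 * h)"
    unfolding abs_mult by (intro mult_left_mono sum_mono mult_mono) (use xy m_le in auto)
  also have "\<dots> = 2 * pi * real D ^ 3 * h"
    by (simp add: power2_eq_square power3_eq_cube)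
  finally show ?thesis by simp
qed

lemma basis2_Lipschitz:
  assumes j: "j \<in> frequency_indices t" "t \<le> (real D)\<^sup>2" and k: "k \<in> frequency_indices t'" "t' \<le> (real D)\<^sup>2"
    and h: "\<And>l. l < D \<Longrightarrow> \<bar>fst z l - fst w l\<bar> \<le> h" "\<And>l. l < D \<Longrightarrow> \<bar>snd z l - snd w l\<bar> \<le> h"
  shows "\<bar>basis2 j k z - basis2 j k w\<bar> \<le> 8 * pi * real D ^ 3 * h"
proof -
  have jk: "j \<in> indices" "k \<in> indices" using j k frequency_indices_subset by auto
  let ?L = "sqrt 2 * (2 * pi * real D ^ 3 * h)"
  have L: "\<bar>basis j (fst z) - basis j (fst w)\<bar> \<le> ?L" "\<bar>basis k (snd z) - basis k (snd w)\<bar> \<le> ?L"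
    by (rule basis_Lipschitz[OF j h(1)], assumption) (rule basis_Lipschitz[OF k h(2)])
  have "basis2 j k z - basis2 j k w
      = basis j (fst z) * (basis k (snd z) - basis k (snd w)) + (basis j (fst z) - basis j (fst w)) * basis k (snd w)"
    by (simp add: basis2_def algebra_simps)
  also have "\<bar>\<dots>\<bar> \<le> \<bar>basis j (fst z)\<bar> * \<bar>basis k (snd z) - basis k (snd w)\<bar>
      + \<bar>basis j (fst z) - basis j (fst w)\<bar> * \<bar>basis k (snd w)\<bar>"
    by (rule order_trans[OF abs_triangle_ineq]) (simp add: abs_mult)
  also have "\<dots> \<le> sqrt 2 * ?L + ?L * sqrt 2"
    using L order_trans[OF abs_ge_zero L(1)]
    by (intro add_mono mult_mono abs_basis_le jk) auto
  also have "\<dots> = 8 * pi * real D ^ 3 * h" by simp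
  finally show ?thesis .
qed

definition cube_grid :: "nat \<Rightarrow> nat \<Rightarrow> (nat \<Rightarrow> real) set" where
  "cube_grid D N = PiE_dflt {..<D} 0 (\<lambda>_. (\<lambda>i. real i / real N) ` {..N})"

lemma finite_cube_grid: "finite (cube_grid D N)"
  unfolding cube_grid_def by (intro finite_PiE_dflt) auto

lemma card_cube_grid: "card (cube_grid D N) \<le> (N + 1) ^ D"
proof -
  have "card (cube_grid D N) = card ((\<lambda>i. real i / real N) ` {..N}) ^ D"
    unfolding cube_grid_def by (subst card_PiE_dflt) auto
  also have "\<dots> \<le> (N + 1) ^ D"
    using card_image_le[of "{..N}" "\<lambda>i. real i / real N"] by (intro power_mono) auto
  finally show ?thesis .
qed

lemma cube_grid_approximates:
  assumes x: "x \<in> space cube" and N: "1 \<le> N"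
  shows "\<exists>y\<in>cube_grid D N. \<forall>l<D. \<bar>x l - y l\<bar> \<le> 1 / real N"
proof
  define q where "q l = nat \<lfloor>real N * x l\<rfloor>" for l
  define y where "y l = (if l < D then real (q l) / real N else 0)" for l
  have x01: "0 \<le> x l" "x l \<le> 1" for l using x by (auto simp: space_cube)
  have q: "real (q l) \<le> real N * x l" "real N * x l \<le> real (q l) + 1" for l
    unfolding q_def using x01[of l] by (auto intro: less_imp_le)
  have "real (q l) \<le> real N" for l
    using q(1)[of l] x01[of l] by (meson mult_left_le of_nat_0_le_iff order_trans)
  then show "y \<in> cube_grid D N"
    by (auto simp: cube_grid_def PiE_dflt_def y_def)
  show "\<forall>l<D. \<bar>x l - y l\<bar> \<le> 1 / real N"
  proof (intro allI impI)
    fix l assume "l < D"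
    then have "x l - y l = (real N * x l - real (q l)) / real N"
      using N by (simp add: y_def field_simps)
    also have "\<bar>\<dots>\<bar> \<le> 1 / real N"
      using q[of l] by (simp add: divide_right_mono)
    finally show "\<bar>x l - y l\<bar> \<le> 1 / real N" .
  qed
qed

text \<open>
  Union bound over the \<open>(N + 1) ^ (2 * D)\<close> points of a grid, and the Lipschitz bound between grid points. The
  variance proxy at a point is at most \<open>4 * card S\<close> because every product of two basis functions is bounded by \<open>2\<close>.
\<close>

lemma card_signs_large_sup:
  assumes S: "finite S" "S \<noteq> {}" "S \<subseteq> frequency_indices t \<times> frequency_indices t'"
    and t: "t \<le> (real D)\<^sup>2" "t' \<le> (real D)\<^sup>2" and N: "1 \<le> N" and u: "0 \<le> u"
  shows "card {\<zeta>\<in>signs S. \<exists>z\<in>space cube2. u + 8 * pi * real D ^ 3 * card S / N < \<bar>signed_sum S \<zeta> z\<bar>}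
    \<le> 2 ^ card S * (2 * real (N + 1) ^ (2 * D) * exp (- (u\<^sup>2 / (8 * card S))))"
proof -
  define Z where "Z = cube_grid D N \<times> cube_grid D N"
  have Z: "finite Z" by (simp add: Z_def finite_cube_grid)
  let ?b = "\<lambda>z jk. basis2 (fst jk) (snd jk) z"
  let ?B = "{\<zeta>\<in>signs S. \<exists>z\<in>space cube2. u + 8 * pi * real D ^ 3 * card S / N < \<bar>signed_sum S \<zeta> z\<bar>}"
  have S_idx: "fst i \<in> frequency_indices t" "snd i \<in> frequency_indices t'" if "i \<in> S" for i
    using S(3) that by auto
  have sub: "?B \<subseteq> {\<zeta>\<in>signs S. \<exists>z\<in>Z. u \<le> \<bar>\<Sum>i\<in>S. \<zeta> i * ?b z i\<bar>}"
  proof safe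
    fix \<zeta> z assume \<zeta>: "\<zeta> \<in> signs S" and z: "z \<in> space cube2"
      and large: "u + 8 * pi * real D ^ 3 * card S / N < \<bar>signed_sum S \<zeta> z\<bar>"
    have z': "fst z \<in> space cube" "snd z \<in> space cube"
      using z by (auto simp: cube2_def space_pair_measure)
    obtain x where x: "x \<in> cube_grid D N" "\<forall>l<D. \<bar>fst z l - x l\<bar> \<le> 1 / real N"
      using cube_grid_approximates[OF z'(1) N] by blast
    obtain y where y: "y \<in> cube_grid D N" "\<forall>l<D. \<bar>snd z l - y l\<bar> \<le> 1 / real N"
      using cube_grid_approximates[OF z'(2) N] by blast
    (* Moving to the nearest grid point changes each summand by at most the Lipschitz constant
       times the mesh. *)
    have "\<bar>signed_sum S \<zeta> z - signed_sum S \<zeta> (x, y)\<bar> = \<bar>\<Sum>i\<in>S. \<zeta> i * (?b z i - ?b (x, y) i)\<bar>"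
      by (simp add: signed_sum_def right_diff_distrib sum_subtractf)
    also have "\<dots> \<le> (\<Sum>i\<in>S. \<bar>\<zeta> i\<bar> * \<bar>?b z i - ?b (x, y) i\<bar>)"
      by (rule order_trans[OF sum_abs]) (simp add: abs_mult)
    also have "\<dots> \<le> (\<Sum>i\<in>S. 1 * (8 * pi * real D ^ 3 * (1 / real N)))"
    proof (intro sum_mono mult_mono)
      fix i assume i: "i \<in> S"
      show "\<bar>\<zeta> i\<bar> \<le> 1" using signs_abs[OF \<zeta> i] by simp
      show "\<bar>?b z i - ?b (x, y) i\<bar> \<le> 8 * pi * real D ^ 3 * (1 / real N)"
        by (rule basis2_Lipschitz[OF S_idx(1)[OF i] t(1) S_idx(2)[OF i] t(2)]) (use x y in auto)
    qed auto
    also have "\<dots> = 8 * pi * real D ^ 3 * card S / N" by simp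
    finally have "u \<le> \<bar>signed_sum S \<zeta> (x, y)\<bar>" using large by linarith
    then show "\<exists>z\<in>Z. u \<le> \<bar>\<Sum>i\<in>S. \<zeta> i * ?b z i\<bar>"
      using x y by (intro bexI[of _ "(x, y)"]) (auto simp: Z_def signed_sum_def)
  qed
  have "real (card ?B) \<le> real (card {\<zeta>\<in>signs S. \<exists>z\<in>Z. u \<le> \<bar>\<Sum>i\<in>S. \<zeta> i * ?b z i\<bar>})"
    unfolding of_nat_le_iff by (rule card_mono[OF _ sub]) (use finite_signs[OF S(1)] in auto)
  also have "\<dots> \<le> 2 ^ card S * (2 * real (card Z) * exp (- (u\<^sup>2 / (2 * (4 * real (card S))))))"
  proof (rule card_signs_tail_union[OF S(1) Z _ _ u])
    fix z
    have "(\<Sum>i\<in>S. (?b z i)\<^sup>2) \<le> (\<Sum>i\<in>S. 4)"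
    proof (rule sum_mono)
      fix i assume "i \<in> S"
      then have "fst i \<in> indices" "snd i \<in> indices"
        using S_idx frequency_indices_subset by blast+
      then have "\<bar>?b z i\<bar>\<^sup>2 \<le> 2\<^sup>2" by (intro power_mono abs_basis2_le) auto
      then show "(?b z i)\<^sup>2 \<le> 4" by simp
    qed
    then show "(\<Sum>i\<in>S. (?b z i)\<^sup>2) \<le> 4 * real (card S)" by simp
    show "0 < 4 * real (card S)" using S by (simp add: card_gt_0_iff)
  qed
  also have "\<dots> \<le> 2 ^ card S * (2 * real (N + 1) ^ (2 * D) * exp (- (u\<^sup>2 / (8 * card S))))"
  proof -
    have "card Z \<le> (N + 1) ^ D * (N + 1) ^ D"
      unfolding Z_def card_cartesian_product by (intro mult_mono card_cube_grid) auto
    then have "real (card Z) \<le> real ((N + 1) ^ (2 * D))"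
      unfolding of_nat_le_iff by (simp add: mult_2 power_add)
    then show ?thesis by (intro mult_left_mono mult_mono) auto
  qed
  finally show ?thesis .
qed

section \<open>The critical number of coefficients\<close>

lemma M_fun_eq_0:
  assumes "0 \<le> t" "t < 1"
  shows "M_fun t = 0"
proof -
  have "nat \<lfloor>t\<rfloor> = 0" using assms by linarith
  then show ?thesis using M_fun_eq_sum[OF assms(1)] by simp
qed

lemma M_fun_ge_1:
  assumes "1 \<le> t"
  shows "1 \<le> M_fun t"
proof -
  let ?e = "\<lambda>l::nat. if l = 0 then 1 else 0 :: nat"
  have "?e \<noteq> (\<lambda>_. 0)" by (metis zero_neq_one)
  then have "card {\<lambda>_. 0, ?e} = 2" by simp
  moreover have "card {\<lambda>_. 0, ?e} \<le> card (frequencies t)"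
    by (rule card_mono[OF finite_frequencies]) (use assms in \<open>auto simp: frequencies_def\<close>)
  ultimately have "2 \<le> real (card (frequencies t))" by simp
  then show ?thesis using card_frequencies[of t] assms by simp
qed

lemma M_fun_nonneg: "0 \<le> t \<Longrightarrow> 0 \<le> M_fun t"
  using M_fun_eq_0[of t] M_fun_ge_1[of t] by (cases "t < 1") auto

text \<open>
  The logarithm of the largest squared weight that is admitted when \<open>m\<close> coefficients are perturbed.
\<close>

abbreviation log_level :: "real \<Rightarrow> nat \<Rightarrow> real" where
  "log_level t m \<equiv> ln (t / sqrt m)"

text \<open>
  The set whose minimum is \<open>m0\<close> contains \<open>\<lceil>t\<^sup>2\<rceil>\<close>, where the level is so close to zero that
  \<open>M_fun\<close> vanishes, and it does not contain \<open>1\<close> once \<open>t\<close> is large. Hence the predecessor \<open>m\<close> of \<open>m0\<close> is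
  positive, fails the defining inequality, and lies below \<open>t\<^sup>2\<close>, so that its level is nonnegative.
\<close>

lemma m0_predecessor:
  assumes s: "0 < s\<^sub>X" "0 < s\<^sub>Y" and t: "exp (2 * s\<^sub>X) \<le> t" "exp (2 * s\<^sub>Y) \<le> t" "1 / s\<^sub>X \<le> t" "1 / s\<^sub>Y \<le> t"
  obtains m where "0 < m" "m0 s\<^sub>X s\<^sub>Y t \<le> 2 * m" "0 \<le> log_level t m"
    "m / 4 \<le> M_fun ((log_level t m)\<^sup>2 / (4 * s\<^sub>X\<^sup>2)) * M_fun ((log_level t m)\<^sup>2 / (4 * s\<^sub>Y\<^sup>2))"
proof -
  let ?P = "\<lambda>m. 0 < m \<and> M_fun ((log_level t m)\<^sup>2 / (4 * s\<^sub>X\<^sup>2)) * M_fun ((log_level t m)\<^sup>2 / (4 * s\<^sub>Y\<^sup>2)) < m / 4"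
  have m0: "m0 s\<^sub>X s\<^sub>Y t = (LEAST m. ?P m)" by (simp add: m0_def)
  have "1 \<le> exp (2 * s\<^sub>X)" using s(1) by simp
  then have t1: "1 \<le> t" using t(1) by (rule order_trans)
  define m1 where "m1 = nat \<lceil>t\<^sup>2\<rceil>"
  have tt: "1 \<le> t\<^sup>2" using t1 by (rule one_le_power)
  have m1: "t\<^sup>2 \<le> real m1" "real m1 < t\<^sup>2 + 1" "0 < m1"
    unfolding m1_def using tt by linarith+
  have P1: "?P m1"
  proof -
    have m1_pos: "0 < real m1" using m1 by simp
    have "2 * ln (t / sqrt m1) = 2 * ln t - ln m1"
      using t1 m1_pos by (simp add: ln_div ln_sqrt)
    also have "\<dots> = - ln (real m1 / t\<^sup>2)"
      using t1 m1_pos by (simp add: ln_div ln_realpow)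
    finally have L: "2 * log_level t m1 = - ln (real m1 / t\<^sup>2)" .
    have "0 \<le> ln (real m1 / t\<^sup>2)" using m1 tt t1 by (intro ln_ge_zero) (simp add: le_divide_eq)
    moreover have "ln (real m1 / t\<^sup>2) \<le> 1 / t"
    proof -
      have "real m1 / t\<^sup>2 \<le> 1 + 1 / t\<^sup>2" using m1 tt t1 by (simp add: field_simps)
      then have "ln (real m1 / t\<^sup>2) \<le> ln (1 + 1 / t\<^sup>2)" using m1_pos tt t1 by (subst ln_le_cancel_iff) (auto intro: add_pos_nonneg)
      also have "\<dots> \<le> 1 / t\<^sup>2" by (rule ln_add_one_self_le_self) simp
      also have "\<dots> \<le> 1 / t" using t1 by (simp add: field_simps power2_eq_square)
      finally show ?thesis .
    qed
    (* At m1 the level is at most 1 / (2 t) in absolute value, hence below 2 s, and M_fun vanishes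
       on [0, 1). *)
    ultimately have L_le: "2 * \<bar>log_level t m1\<bar> \<le> 1 / t" using L by linarith
    have "M_fun ((log_level t m1)\<^sup>2 / (4 * s\<^sup>2)) = 0" if "0 < s" "1 / s \<le> t" for s
    proof (rule M_fun_eq_0)
      have "1 / t \<le> s" using that t1 by (simp add: field_simps)
      then have "\<bar>log_level t m1\<bar> < 2 * s" using L_le that by linarith
      then have "\<bar>log_level t m1\<bar>\<^sup>2 < (2 * s)\<^sup>2" by (intro power_strict_mono) auto
      then show "(log_level t m1)\<^sup>2 / (4 * s\<^sup>2) < 1" using that by (simp add: power_mult_distrib)
    qed simp
    then show ?thesis using s t m1 by simp
  qed
  have not1: "\<not> ?P 1"
  proof -
    have "1 \<le> M_fun ((log_level t 1)\<^sup>2 / (4 * s\<^sup>2))" if "0 < s" "exp (2 * s) \<le> t" for s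
    proof (rule M_fun_ge_1)
      have "2 * s \<le> ln t" using that t1 by (simp add: ln_ge_iff)
      then have "(2 * s)\<^sup>2 \<le> (ln t)\<^sup>2" using that by (intro power_mono) auto
      then show "1 \<le> (log_level t 1)\<^sup>2 / (4 * s\<^sup>2)" using that by (simp add: power_mult_distrib)
    qed
    note ge = this[OF s(1) t(1)] this[OF s(2) t(2)]
    have "1 * 1 \<le> M_fun ((log_level t 1)\<^sup>2 / (4 * s\<^sub>X\<^sup>2)) * M_fun ((log_level t 1)\<^sup>2 / (4 * s\<^sub>Y\<^sup>2))"
      by (rule mult_mono[OF ge]) (use ge in auto)
    then show ?thesis by simp
  qed
  have "?P (m0 s\<^sub>X s\<^sub>Y t)" unfolding m0 using P1 by (rule LeastI)
  then have ge2: "2 \<le> m0 s\<^sub>X s\<^sub>Y t" using not1 by (metis One_nat_def Suc_1 Suc_leI le_neq_implies_less)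
  have le: "m0 s\<^sub>X s\<^sub>Y t \<le> m1" unfolding m0 using P1 by (rule Least_le)
  define m where "m = m0 s\<^sub>X s\<^sub>Y t - 1"
  have m: "0 < m" "m < m0 s\<^sub>X s\<^sub>Y t" "m0 s\<^sub>X s\<^sub>Y t \<le> 2 * m" "real m + 1 \<le> real m1"
    using ge2 le by (auto simp: m_def)
  show ?thesis
  proof (rule that[OF m(1) m(3)])
    have "real m \<le> t\<^sup>2" using m(4) m1(2) by linarith
    then have "sqrt m \<le> t" using t1 by (intro real_le_lsqrt) auto
    then show "0 \<le> log_level t m" using m(1) by (intro ln_ge_zero) (simp add: le_divide_eq)
    have "\<not> ?P m" using m(2) unfolding m0 by (rule not_less_Least)
    then show "m / 4 \<le> M_fun ((log_level t m)\<^sup>2 / (4 * s\<^sub>X\<^sup>2)) * M_fun ((log_level t m)\<^sup>2 / (4 * s\<^sub>Y\<^sup>2))"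
      using m(1) by simp
  qed
qed

text \<open>
  With \<open>M_fun_le\<close> the lower bound on the number of pairs becomes \<open>m / 4 \<le> exp (c0 * L / s)\<close>,
  where \<open>s\<close> is the harmonic smoothness and \<open>L = ln t - ln m / 2\<close>. This is a linear inequality for \<open>ln m\<close>;
  solving it with \<open>ln t \<le> (1 + \<kappa>) ln n\<close> gives \<open>ln m \<le> ln 4 + 2 (1 - \<kappa>) ln n\<close>.
\<close>

lemma sqrt_coefficient_number_le:
  fixes m n :: nat
  assumes s: "0 < s\<^sub>X" "0 < s\<^sub>Y" and m: "0 < m" and n: "1 \<le> n" and t: "0 < t"
    and level: "0 \<le> log_level t m"
      "m / 4 \<le> M_fun ((log_level t m)\<^sup>2 / (4 * s\<^sub>X\<^sup>2)) * M_fun ((log_level t m)\<^sup>2 / (4 * s\<^sub>Y\<^sup>2))"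
    and \<kappa>: "\<kappa> = harmonic_smoothness s\<^sub>X s\<^sub>Y / (harmonic_smoothness s\<^sub>X s\<^sub>Y + c0)" and t_le: "t \<le> real n powr (1 + \<kappa>)"
  shows "sqrt m / n \<le> 2 * real n powr (- \<kappa>)"
proof -
  define s where "s = harmonic_smoothness s\<^sub>X s\<^sub>Y"
  define L where "L = log_level t m"
  have s_pos: "0 < s" unfolding s_def harmonic_smoothness_def using s by (simp add: add_pos_pos)
  have s_inv: "1 / (2 * s\<^sub>X) + 1 / (2 * s\<^sub>Y) = 1 / s"
    unfolding s_def harmonic_smoothness_def using s by (simp add: field_simps)
  have c0: "0 < c0" by (rule c0_pos)
  have L0: "0 \<le> L" using level(1) by (simp add: L_def)
  have M: "M_fun (L\<^sup>2 / (4 * q\<^sup>2)) \<le> exp (c0 * L / (2 * q))" if "0 < q" for q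
  proof -
    have "sqrt (L\<^sup>2 / (4 * q\<^sup>2)) = L / (2 * q)"
      using that L0 by (simp add: real_sqrt_divide real_sqrt_mult)
    then show ?thesis using M_fun_le[of "L\<^sup>2 / (4 * q\<^sup>2)"] by simp
  qed
  have "m / 4 \<le> exp (c0 * L / (2 * s\<^sub>X)) * exp (c0 * L / (2 * s\<^sub>Y))"
    using level(2) unfolding L_def [symmetric]
    by (rule order_trans) (intro mult_mono M s M_fun_nonneg; simp)
  also have "\<dots> = exp (c0 * L / s)"
  proof -
    have "c0 * L / (2 * s\<^sub>X) + c0 * L / (2 * s\<^sub>Y) = c0 * L * (1 / (2 * s\<^sub>X) + 1 / (2 * s\<^sub>Y))"
      by (simp add: distrib_left)
    then show ?thesis unfolding s_inv by (simp add: exp_add [symmetric])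
  qed
  finally have "ln (m / 4) \<le> ln (exp (c0 * L / s))"
    using m by (subst ln_le_cancel_iff) auto
  then have "ln (m / 4) \<le> c0 * L / s" by simp
  then have 1: "s * (ln m - ln 4) \<le> c0 * L"
    using m s_pos by (simp add: ln_div field_simps)
  have L_eq: "L = ln t - ln m / 2" using t m by (simp add: L_def ln_div ln_sqrt)
  have ln_n: "0 \<le> ln (real n)" using n by simp
  have "ln t \<le> ln (real n powr (1 + \<kappa>))" using t t_le n by (subst ln_le_cancel_iff) auto
  then have ln_t: "ln t \<le> (1 + \<kappa>) * ln n" using n by (simp add: ln_powr)
  have "(2 * s + c0) * ln m \<le> 2 * s * ln 4 + 2 * c0 * ln t"
    using 1 unfolding L_eq by (simp add: algebra_simps)
  also have "\<dots> \<le> (2 * s + c0) * ln 4 + 2 * c0 * ((1 + \<kappa>) * ln n)"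
    using ln_t c0 by (intro add_mono mult_right_mono mult_left_mono) auto
  also have "(1 + \<kappa>) = (2 * s + c0) * (1 / (s + c0))"
    unfolding \<kappa> s_def [symmetric] using s_pos c0 by (simp add: field_simps)
  finally have "(2 * s + c0) * ln m \<le> (2 * s + c0) * (ln 4 + 2 * (c0 / (s + c0)) * ln n)"
    by (simp add: distrib_left divide_inverse mult_ac)
  then have "ln m \<le> ln 4 + 2 * (c0 / (s + c0)) * ln n"
    using s_pos c0 by (simp add: mult_le_cancel_left_pos)
  also have "c0 / (s + c0) = 1 - \<kappa>"
    unfolding \<kappa> s_def [symmetric] using s_pos c0 by (simp add: field_simps)
  also have "ln (4::real) = 2 * ln 2" using ln_realpow[of 2 2] by simp
  finally have "ln (sqrt m / n) \<le> ln (2 * real n powr (- \<kappa>))"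
    using m n by (simp add: ln_div ln_mult ln_sqrt ln_powr algebra_simps)
  then show ?thesis using m n by simp
qed

section \<open>The lower bound\<close>

lemma frequency_indices_nonconstant: "frequency_indices t \<subseteq> nonconstant_indices"
  using frequency_indices_subset[of t] by (auto simp: frequency_indices_def)

lemma exp_weights_le:
  assumes j: "j \<in> frequency_indices (L\<^sup>2 / (4 * s\<^sub>X\<^sup>2))" and k: "k \<in> frequency_indices (L\<^sup>2 / (4 * s\<^sub>Y\<^sup>2))"
    and s: "0 < s\<^sub>X" "0 < s\<^sub>Y" and L: "0 \<le> L"
  shows "(exp_weights s\<^sub>X s\<^sub>Y j k)\<^sup>2 \<le> ennreal (exp L)"
proof -
  have half: "s * sqrt (idx_size i) \<le> L / 2" if "i \<in> frequency_indices (L\<^sup>2 / (4 * s\<^sup>2))" "0 < s" for i s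
  proof -
    have "sqrt (idx_size i) \<le> sqrt (L\<^sup>2 / (4 * s\<^sup>2))"
      using idx_size_frequency_indices(1)[OF that(1)] by simp
    also have "\<dots> = L / (2 * s)"
      using that(2) L by (simp add: real_sqrt_divide real_sqrt_mult)
    finally show ?thesis using that(2) by (simp add: field_simps)
  qed
  define M where "M = max (exp (s\<^sub>X * sqrt (idx_size j))) (exp (s\<^sub>Y * sqrt (idx_size k)))"
  have "exp_weights s\<^sub>X s\<^sub>Y j k = ennreal M"
    using idx_size_frequency_indices(2)[OF j] idx_size_frequency_indices(2)[OF k]
    by (simp add: exp_weights_def M_def)
  moreover have M: "0 \<le> M" "M \<le> exp (L / 2)"
    using half[OF j s(1)] half[OF k s(2)] by (auto simp: M_def le_max_iff_disj)
  moreover have "M\<^sup>2 \<le> exp L"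
  proof -
    have "M\<^sup>2 \<le> (exp (L / 2))\<^sup>2" using M by (intro power_mono) auto
    also have "\<dots> = exp L" by (simp add: exp_double [symmetric])
    finally show ?thesis .
  qed
  ultimately show ?thesis by (simp add: ennreal_power ennreal_leI)
qed

text \<open>
  The construction for given parameters: \<open>D\<close> bounds the number of active coordinates and the square root of the
  frequencies, \<open>N\<close> is the resolution of the grid, and \<open>u\<close> is the threshold for the random sum at
  the points of the grid.
\<close>

lemma separation_radius_ge_of_frequencies:
  fixes L \<delta> r A p \<eta> \<alpha> \<beta> u :: real and m n D N :: nat
  assumes s: "0 < s\<^sub>X" "0 < s\<^sub>Y" and L: "0 \<le> L" "L / (2 * s\<^sub>X) \<le> D" "L / (2 * s\<^sub>Y) \<le> D"
    and m: "0 < m" "m / 4 \<le> M_fun (L\<^sup>2 / (4 * s\<^sub>X\<^sup>2)) * M_fun (L\<^sup>2 / (4 * s\<^sub>Y\<^sup>2))"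
    and smooth: "\<delta>\<^sup>2 * m * exp L \<le> r\<^sup>2"
    and chi2: "exp (m * (n * \<delta>\<^sup>2)\<^sup>2 / 2) \<le> (1 + \<eta>\<^sup>2) * (1 - p)\<^sup>2"
    and \<eta>: "0 \<le> \<eta>" "\<beta> < 1 - \<alpha> - \<eta>" and \<alpha>: "0 \<le> \<alpha>" and A: "1 \<le> A" and \<delta>: "0 \<le> \<delta>"
    and tail: "2 * real (N + 1) ^ (2 * D) * exp (- (u\<^sup>2 / (8 * m))) \<le> p" "p < 1" and N: "1 \<le> N" and u: "0 \<le> u"
    and sup: "\<delta> * (u + 8 * pi * real D ^ 3 * m / N) \<le> min 1 (A - 1)"
  shows "ereal (sqrt (\<delta>\<^sup>2 * m)) \<le> separation_radius n \<alpha> \<beta> (exp_weights s\<^sub>X s\<^sub>Y, r, A)"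
proof -
  let ?X = "frequency_indices (L\<^sup>2 / (4 * s\<^sub>X\<^sup>2))" and ?Y = "frequency_indices (L\<^sup>2 / (4 * s\<^sub>Y\<^sup>2))"
  have "real (card (?X \<times> ?Y)) = 4 * (M_fun (L\<^sup>2 / (4 * s\<^sub>X\<^sup>2)) * M_fun (L\<^sup>2 / (4 * s\<^sub>Y\<^sup>2)))"
    by (simp add: card_cartesian_product card_frequency_indices)
  then have "m \<le> card (?X \<times> ?Y)" using m(2) by linarith
  then obtain S where S: "S \<subseteq> ?X \<times> ?Y" "card S = m" "finite S"
    by (rule obtain_subset_with_card_n)
  interpret perturbation S
    using S frequency_indices_nonconstant by unfold_locales blast+
  have deg: "L\<^sup>2 / (4 * s\<^sup>2) \<le> (real D)\<^sup>2" if "0 < s" "L / (2 * s) \<le> D" for s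
  proof -
    have "(L / (2 * s))\<^sup>2 \<le> (real D)\<^sup>2" using that L(1) by (intro power_mono) auto
    then show ?thesis by (simp add: power_divide power_mult_distrib)
  qed
  define R where "R = u + 8 * pi * real D ^ 3 * m / N"
  define B where "B = {\<zeta>\<in>signs S. \<exists>z\<in>space cube2. R < \<bar>signed_sum S \<zeta> z\<bar>}"
  define G where "G = signs S - B"
  have "card B \<le> 2 ^ card S * (2 * real (N + 1) ^ (2 * D) * exp (- (u\<^sup>2 / (8 * card S))))"
    unfolding B_def R_def S(2) [symmetric]
    by (rule card_signs_large_sup[OF S(3) _ S(1) deg[OF s(1) L(2)] deg[OF s(2) L(3)] N u]) (use S m in auto)
  also have "\<dots> \<le> 2 ^ card S * p" using tail S(2) by (intro mult_left_mono) auto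
  finally have B: "card B \<le> 2 ^ card S * p" .
  have "card B \<le> card (signs S)" "card G = card (signs S) - card B"
    unfolding G_def by (auto simp: B_def finite_signs S(3) intro!: card_mono card_Diff_subset)
  then have G: "(1 - p) * 2 ^ card S \<le> card G"
    using B by (simp add: card_signs S(3) of_nat_diff algebra_simps)
  have "ereal (sqrt (\<delta>\<^sup>2 * card S)) \<le> separation_radius n \<alpha> \<beta> (exp_weights s\<^sub>X s\<^sub>Y, r, A)"
  proof (rule separation_radius_ge[where w = "exp L" and G = G and p = p and \<eta> = \<eta>])
    show "(exp_weights s\<^sub>X s\<^sub>Y j k)\<^sup>2 \<le> ennreal (exp L)" if "(j, k) \<in> S" for j k
      using that S(1) by (intro exp_weights_le s L(1)) auto
    show "\<bar>\<delta> * signed_sum S \<zeta> z\<bar> \<le> min 1 (A - 1)" if "\<zeta> \<in> G" "z \<in> space cube2" for \<zeta> z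
    proof -
      have "\<bar>signed_sum S \<zeta> z\<bar> \<le> R" using that by (auto simp: G_def B_def)
      then have "\<bar>\<delta> * signed_sum S \<zeta> z\<bar> \<le> \<delta> * R" using \<delta> by (simp add: abs_mult mult_left_mono)
      also have "\<dots> \<le> min 1 (A - 1)" using sup by (simp add: R_def)
      finally show ?thesis .
    qed
  qed (use smooth chi2 \<eta> \<alpha> A tail(2) G S(2) in \<open>auto simp: G_def\<close>)
  then show ?thesis by (simp add: S(2))
qed

text \<open>
  The three ways in which \<open>n\<close> has to be large: few sign vectors are bad at a grid point, the
  perturbation is small at the grid points, and it varies little between them.
\<close>

lemma eventually_net_conditions:
  fixes \<kappa> \<sigma> p b :: real
  assumes "0 < \<kappa>" "0 < \<sigma>" "0 < p" "0 < b"
  shows "\<forall>\<^sub>F x in at_top. 2 * exp (2 * (ln x / \<sigma> + 1) * ln (x\<^sup>2 + 1) - x powr (\<kappa> / 2) / 8) < p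
    \<and> 2 * x powr (- (\<kappa> / 2)) < (b / 2)\<^sup>2 \<and> 24 * pi * (ln x / \<sigma> + 1) ^ 3 / x < b / 2"
proof (intro eventually_conj)
  have "((\<lambda>x. 2 * exp (2 * (ln x / \<sigma> + 1) * ln (x\<^sup>2 + 1) - x powr (\<kappa> / 2) / 8)) \<longlongrightarrow> 0) at_top"
    using assms by real_asymp
  then show "\<forall>\<^sub>F x in at_top. 2 * exp (2 * (ln x / \<sigma> + 1) * ln (x\<^sup>2 + 1) - x powr (\<kappa> / 2) / 8) < p"
    by (rule order_tendstoD) (rule assms)
  have "((\<lambda>x. 2 * x powr (- (\<kappa> / 2))) \<longlongrightarrow> 0) at_top"
    using assms by real_asymp
  then show "\<forall>\<^sub>F x in at_top. 2 * x powr (- (\<kappa> / 2)) < (b / 2)\<^sup>2"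
    by (rule order_tendstoD) (use assms in simp)
  have "((\<lambda>x. 24 * pi * (ln x / \<sigma> + 1) ^ 3 / x) \<longlongrightarrow> 0) at_top"
    using assms by real_asymp
  then show "\<forall>\<^sub>F x in at_top. 24 * pi * (ln x / \<sigma> + 1) ^ 3 / x < b / 2"
    by (rule order_tendstoD) (use assms in simp)
qed

theorem proposition15:
  fixes \<alpha> \<beta> s\<^sub>X s\<^sub>Y A \<epsilon> :: real
  assumes "0 < \<alpha>" "\<alpha> < 1" "0 < \<beta>" "\<beta> < 1" "\<alpha> + \<beta> < 1"
    and "0 < s\<^sub>X" "0 < s\<^sub>Y" "1 < A" "0 < \<epsilon>"
  shows "\<exists>C > 0. \<exists>C' > 0. \<forall>(n::nat) (r::real).
    n \<ge> 1 \<and> r > 0 \<and>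
    r\<^sup>2 \<le> real n powr (harmonic_smoothness s\<^sub>X s\<^sub>Y / (harmonic_smoothness s\<^sub>X s\<^sub>Y + c0) - \<epsilon>) \<and>
    min (real n) (real n * r\<^sup>2) \<ge> C' \<longrightarrow>
    separation_radius n \<alpha> \<beta> (exp_weights s\<^sub>X s\<^sub>Y, r, A)
      \<ge> ereal (C * real (m0 s\<^sub>X s\<^sub>Y (real n * r\<^sup>2)) powr (1/4) / sqrt (real n))"
proof -
  note s = \<open>0 < s\<^sub>X\<close> \<open>0 < s\<^sub>Y\<close>
  (* Half of the slack 1 - \<alpha> - \<beta> is the distance allowed between the mixture and the null. The
     constant c makes the chi-square distance at most \<eta>\<^sup>2 / 2, and p is the proportion of signs that
     may then be dropped without exceeding \<eta>\<^sup>2. *)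
  define \<eta> where "\<eta> = (1 - \<alpha> - \<beta>) / 2"
  define c where "c = min 1 (sqrt (2 * ln (1 + \<eta>\<^sup>2 / 2)))"
  define p where "p = 1 - sqrt ((1 + \<eta>\<^sup>2 / 2) / (1 + \<eta>\<^sup>2))"
  define b where "b = min 1 (A - 1)"
  define \<kappa> where "\<kappa> = harmonic_smoothness s\<^sub>X s\<^sub>Y / (harmonic_smoothness s\<^sub>X s\<^sub>Y + c0)"
  define \<sigma> where "\<sigma> = min s\<^sub>X s\<^sub>Y"
  have \<eta>: "0 < \<eta>" "\<beta> < 1 - \<alpha> - \<eta>" using assms by (auto simp: \<eta>_def field_simps)
  have \<eta>2: "0 < \<eta>\<^sup>2" using \<eta> by simp
  have ln_pos: "0 < ln (1 + \<eta>\<^sup>2 / 2)" using \<eta>2 by (intro ln_gt_zero) simp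
  have c: "0 < c" "c \<le> 1" using ln_pos by (auto simp: c_def)
  have "c\<^sup>2 \<le> (sqrt (2 * ln (1 + \<eta>\<^sup>2 / 2)))\<^sup>2" using c by (intro power_mono) (auto simp: c_def)
  then have "c\<^sup>2 / 2 \<le> ln (1 + \<eta>\<^sup>2 / 2)" using ln_pos by simp
  then have "exp (c\<^sup>2 / 2) \<le> exp (ln (1 + \<eta>\<^sup>2 / 2))" unfolding exp_le_cancel_iff .
  then have c_exp: "exp (c\<^sup>2 / 2) \<le> 1 + \<eta>\<^sup>2 / 2" using \<eta>2 by simp
  have "0 < (1 + y / 2) / (1 + y) \<and> (1 + y / 2) / (1 + y) < 1" if "0 < y" for y :: real
    using that by (auto simp: divide_less_eq intro!: divide_pos_pos)
  from this[OF \<eta>2] have "0 < (1 + \<eta>\<^sup>2 / 2) / (1 + \<eta>\<^sup>2)" "(1 + \<eta>\<^sup>2 / 2) / (1 + \<eta>\<^sup>2) < 1"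
    by blast+
  then have p: "0 < p" "p < 1" unfolding p_def by (simp_all only: diff_gt_0_iff_gt real_sqrt_lt_1_iff diff_less_eq real_sqrt_gt_0_iff less_add_same_cancel1)
  have "(1 - p)\<^sup>2 = (1 + \<eta>\<^sup>2 / 2) / (1 + \<eta>\<^sup>2)" using \<eta>2 by (simp add: p_def)
  then have p_c: "exp (c\<^sup>2 / 2) \<le> (1 + \<eta>\<^sup>2) * (1 - p)\<^sup>2" using c_exp pos_add_strict[OF zero_less_one \<eta>2] by simp
  have b: "0 < b" using assms by (simp add: b_def)
  have hs: "0 < harmonic_smoothness s\<^sub>X s\<^sub>Y"
    unfolding harmonic_smoothness_def using s by (simp add: add_pos_pos)
  have \<kappa>: "0 < \<kappa>" "\<kappa> < 1" using hs c0_pos by (auto simp: \<kappa>_def divide_less_eq)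
  have \<sigma>: "0 < \<sigma>" "\<sigma> \<le> s\<^sub>X" "\<sigma> \<le> s\<^sub>Y" using s by (auto simp: \<sigma>_def)
  obtain x0 where x0: "\<And>x. x0 \<le> x \<Longrightarrow>
      2 * exp (2 * (ln x / \<sigma> + 1) * ln (x\<^sup>2 + 1) - x powr (\<kappa> / 2) / 8) < p
      \<and> 2 * x powr (- (\<kappa> / 2)) < (b / 2)\<^sup>2 \<and> 24 * pi * (ln x / \<sigma> + 1) ^ 3 / x < b / 2"
    using eventually_net_conditions[OF \<kappa>(1) \<sigma>(1) p(1) b] unfolding eventually_at_top_linorder by blast
  define C' where "C' = max 1 (max x0 (max (max (exp (2 * s\<^sub>X)) (exp (2 * s\<^sub>Y))) (max (1 / s\<^sub>X) (1 / s\<^sub>Y))))"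
  have bound: "ereal (sqrt c / 2 * real (m0 s\<^sub>X s\<^sub>Y (real n * r\<^sup>2)) powr (1/4) / sqrt (real n))
      \<le> separation_radius n \<alpha> \<beta> (exp_weights s\<^sub>X s\<^sub>Y, r, A)"
    if n1: "n \<ge> 1" and r: "r > 0" and r_le: "r\<^sup>2 \<le> real n powr (\<kappa> - \<epsilon>)"
      and large: "min (real n) (real n * r\<^sup>2) \<ge> C'" for n :: nat and r :: real
  proof -
    define t where "t = real n * r\<^sup>2"
    have n: "0 < real n" "1 \<le> real n" using n1 by auto
    have t: "exp (2 * s\<^sub>X) \<le> t" "exp (2 * s\<^sub>Y) \<le> t" "1 / s\<^sub>X \<le> t" "1 / s\<^sub>Y \<le> t" "1 \<le> t"
      using large by (auto simp: C'_def t_def)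
    have nx: "2 * exp (2 * (ln n / \<sigma> + 1) * ln ((real n)\<^sup>2 + 1) - real n powr (\<kappa> / 2) / 8) < p"
        "2 * real n powr (- (\<kappa> / 2)) < (b / 2)\<^sup>2" "24 * pi * (ln n / \<sigma> + 1) ^ 3 / n < b / 2"
      using x0[of "real n"] large by (auto simp: C'_def)
    obtain m where m: "0 < m" "m0 s\<^sub>X s\<^sub>Y t \<le> 2 * m" "0 \<le> log_level t m"
        "m / 4 \<le> M_fun ((log_level t m)\<^sup>2 / (4 * s\<^sub>X\<^sup>2)) * M_fun ((log_level t m)\<^sup>2 / (4 * s\<^sub>Y\<^sup>2))"
      by (rule m0_predecessor[OF s t(1-4)])
    define L where "L = log_level t m"
    have m_pos: "0 < real m" "1 \<le> real m" using m(1) by auto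
    have "t \<le> real n * real n powr \<kappa>"
      unfolding t_def using r_le \<open>0 < \<epsilon>\<close> n
      by (intro mult_left_mono order_trans[OF r_le] powr_mono) auto
    then have t_le: "t \<le> real n powr (1 + \<kappa>)" using n by (simp add: powr_add)
    have sqrt_m: "sqrt m / n \<le> 2 * real n powr (- \<kappa>)"
      by (rule sqrt_coefficient_number_le[OF s m(1) n1 _ m(3,4) \<kappa>_def t_le]) (use t in simp)
    (* The level is at most ln t, which is at most 2 ln n, so indices up to that level have at most
       ln n / \<sigma> active coordinates. *)
    define D where "D = nat \<lceil>ln n / \<sigma>\<rceil>"
    have ln_n: "0 \<le> ln n / \<sigma>" using n \<sigma> by simp
    have D: "ln n / \<sigma> \<le> D" "D \<le> ln n / \<sigma> + 1"
      unfolding D_def using ln_n by linarith+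
    have "L = ln t - ln m / 2" using t m_pos by (simp add: L_def ln_div ln_sqrt)
    also have "\<dots> \<le> ln t" using m_pos by simp
    also have "\<dots> \<le> ln (real n powr (1 + \<kappa>))" using t t_le n by (subst ln_le_cancel_iff) auto
    also have "\<dots> = (1 + \<kappa>) * ln n" using n by (simp add: ln_powr)
    also have "\<dots> \<le> 2 * ln n" using \<kappa> n by (intro mult_right_mono) auto
    finally have L_le: "L \<le> 2 * ln n" .
    have L_D: "L / (2 * q) \<le> D" if "\<sigma> \<le> q" for q
    proof -
      have "L / (2 * q) \<le> 2 * ln n / (2 * q)" using L_le that \<sigma> by (intro divide_right_mono) auto
      also have "\<dots> = ln n / q" by simp
      also have "\<dots> \<le> ln n / \<sigma>" using that \<sigma> n by (intro divide_left_mono) auto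
      also have "\<dots> \<le> D" by (rule D)
      finally show ?thesis .
    qed
    have exp_L: "exp L = t / sqrt m" unfolding L_def using t m_pos by simp
    (* The largest amplitude for which the chi-square distance stays bounded: n * \<delta>\<^sup>2 = c / sqrt m. *)
    define \<delta> where "\<delta> = sqrt (c / (n * sqrt m))"
    have \<delta>: "0 \<le> \<delta>" "\<delta>\<^sup>2 = c / (n * sqrt m)" using c n m_pos by (auto simp: \<delta>_def)
    have \<delta>m: "\<delta>\<^sup>2 * m = c * sqrt m / n"
      unfolding \<delta>(2) using n m_pos by (simp add: field_simps)
    (* The factor n powr (\<kappa> / 4) beats the logarithm of the number of grid points and still leaves
       \<delta> * u of order n powr (- \<kappa> / 4). *)
    define u where "u = sqrt m * real n powr (\<kappa> / 4)"
    have "(real n powr (\<kappa> / 4))\<^sup>2 = real n powr (\<kappa> / 2)"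
      by (simp add: power2_eq_square powr_add [symmetric])
    then have u: "0 \<le> u" "u\<^sup>2 = m * real n powr (\<kappa> / 2)"
      by (simp_all add: u_def power_mult_distrib)
    have "ereal (sqrt (\<delta>\<^sup>2 * m)) \<le> separation_radius n \<alpha> \<beta> (exp_weights s\<^sub>X s\<^sub>Y, r, A)"
    proof (rule separation_radius_ge_of_frequencies[where L = L and D = D and N = "n\<^sup>2" and u = u and p = p and \<eta> = \<eta>])
      show "0 < s\<^sub>X" "0 < s\<^sub>Y" "0 < m" "0 \<le> \<eta>" "\<beta> < 1 - \<alpha> - \<eta>" "0 \<le> \<alpha>" "1 \<le> A" "p < 1" "0 \<le> \<delta>" "0 \<le> u" "1 \<le> n\<^sup>2"
        using s m \<eta> assms p \<delta> u n1 by auto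
      show "0 \<le> L" "m / 4 \<le> M_fun (L\<^sup>2 / (4 * s\<^sub>X\<^sup>2)) * M_fun (L\<^sup>2 / (4 * s\<^sub>Y\<^sup>2))"
        using m by (auto simp: L_def)
      show "L / (2 * s\<^sub>X) \<le> D" "L / (2 * s\<^sub>Y) \<le> D" using \<sigma> by (auto intro: L_D)
      have "\<delta>\<^sup>2 * m * exp L = c * r\<^sup>2"
        unfolding \<delta>m exp_L t_def using n m_pos by simp
      also have "\<dots> \<le> r\<^sup>2" using mult_right_mono[OF c(2), of "r\<^sup>2"] by simp
      finally show "\<delta>\<^sup>2 * m * exp L \<le> r\<^sup>2" .
      have "m * (n * \<delta>\<^sup>2)\<^sup>2 = c\<^sup>2"
        unfolding \<delta>(2) using n m_pos by (simp add: power_divide power_mult_distrib)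
      then show "exp (m * (n * \<delta>\<^sup>2)\<^sup>2 / 2) \<le> (1 + \<eta>\<^sup>2) * (1 - p)\<^sup>2" using p_c by simp
      show "2 * real (n\<^sup>2 + 1) ^ (2 * D) * exp (- (u\<^sup>2 / (8 * m))) \<le> p"
      proof -
        have "exp (ln ((real n)\<^sup>2 + 1)) = real (n\<^sup>2 + 1)" by (simp add: add_nonneg_pos)
        then have "real (n\<^sup>2 + 1) ^ (2 * D) = exp (2 * D * ln ((real n)\<^sup>2 + 1))"
          using exp_of_nat_mult[of "2 * D" "ln ((real n)\<^sup>2 + 1)"] by (simp only:)
        also have "\<dots> \<le> exp (2 * (ln n / \<sigma> + 1) * ln ((real n)\<^sup>2 + 1))"
          using D(2) by (auto intro!: mult_right_mono)
        finally have "2 * real (n\<^sup>2 + 1) ^ (2 * D) * exp (- (u\<^sup>2 / (8 * m)))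
            \<le> 2 * exp (2 * (ln n / \<sigma> + 1) * ln ((real n)\<^sup>2 + 1)) * exp (- (u\<^sup>2 / (8 * m)))"
          by (intro mult_right_mono mult_left_mono) auto
        also have tail_eq: "u\<^sup>2 / (8 * m) = real n powr (\<kappa> / 2) / 8" using u m_pos by simp
        also have "2 * exp (2 * (ln n / \<sigma> + 1) * ln ((real n)\<^sup>2 + 1)) * exp (- (real n powr (\<kappa> / 2) / 8))
            = 2 * exp (2 * (ln n / \<sigma> + 1) * ln ((real n)\<^sup>2 + 1) - real n powr (\<kappa> / 2) / 8)"
          by (simp only: mult.assoc exp_add [symmetric] diff_conv_add_uminus)
        finally show ?thesis using nx(1) unfolding tail_eq by linarith
      qed
      have \<delta>u: "\<delta> * u \<le> b / 2"
      proof (rule power2_le_imp_le)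
        have "(\<delta> * u)\<^sup>2 = (\<delta>\<^sup>2 * m) * real n powr (\<kappa> / 2)"
          by (simp add: power_mult_distrib u(2))
        also have "\<dots> = c * (sqrt m / n) * real n powr (\<kappa> / 2)"
          unfolding \<delta>m by simp
        also have "\<dots> \<le> 1 * (2 * real n powr (- \<kappa>)) * real n powr (\<kappa> / 2)"
          using c sqrt_m n m_pos by (intro mult_mono mult_right_mono) auto
        also have "\<dots> = 2 * real n powr (- (\<kappa> / 2))"
          by (simp add: powr_add [symmetric])
        finally show "(\<delta> * u)\<^sup>2 \<le> (b / 2)\<^sup>2" using nx(2) by linarith
      qed (use b in simp)
      have \<delta>_net: "\<delta> * (8 * pi * real D ^ 3 * m / real (n\<^sup>2)) \<le> b / 2"
      proof -
        have "sqrt m / n \<le> 2 * 1"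
          by (rule order_trans[OF sqrt_m]) (use \<kappa> n powr_mono[of "- \<kappa>" 0 "real n"] in auto)
        then have m_n: "sqrt m \<le> 2 * n" using n by (simp add: divide_le_eq)
        have cube_le: "sqrt m * (sqrt m * sqrt m) \<le> 2 * real n * (2 * real n * (2 * real n))"
          by (intro mult_mono) (use m_n in auto)
        have "(\<delta> * m)\<^sup>2 = (\<delta>\<^sup>2 * m) * (sqrt m * sqrt m)"
          by (simp add: power2_eq_square)
        also have "\<dots> = c * (sqrt m * (sqrt m * sqrt m) / n)"
          unfolding \<delta>m by simp
        also have "\<dots> \<le> 1 * (2 * real n * (2 * real n * (2 * real n)) / n)"
          by (intro mult_mono divide_right_mono cube_le) (use c in auto)
        also have "\<dots> \<le> (3 * real n)\<^sup>2" using n by (simp add: power2_eq_square)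
        finally have "\<delta> * m \<le> 3 * real n" by (rule power2_le_imp_le) simp
        then have "\<delta> * m * (8 * pi * real D ^ 3 / real (n\<^sup>2)) \<le> 3 * real n * (8 * pi * real D ^ 3 / real (n\<^sup>2))"
          by (intro mult_right_mono) auto
        also have "\<dots> = 24 * pi * real D ^ 3 / n" using n by (simp add: power2_eq_square)
        also have "\<dots> \<le> 24 * pi * (ln n / \<sigma> + 1) ^ 3 / n"
          using D(2) by (intro divide_right_mono mult_left_mono power_mono) auto
        also have "\<dots> \<le> b / 2" using nx(3) by simp
        also have "\<delta> * m * (8 * pi * real D ^ 3 / real (n\<^sup>2)) = \<delta> * (8 * pi * real D ^ 3 * m / real (n\<^sup>2))"
          by (simp only: times_divide_eq_right mult_ac)
        finally show ?thesis .
      qed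
      show "\<delta> * (u + 8 * pi * real D ^ 3 * m / real (n\<^sup>2)) \<le> min 1 (A - 1)"
        using \<delta>u \<delta>_net unfolding distrib_left b_def [symmetric] by linarith
    qed
    moreover have "sqrt c / 2 * real (m0 s\<^sub>X s\<^sub>Y t) powr (1/4) / sqrt n \<le> sqrt (\<delta>\<^sup>2 * m)"
    proof -
      have "real (m0 s\<^sub>X s\<^sub>Y t) powr (1/4) \<le> (2 * real m) powr (1/4)"
        using m(2) by (intro powr_mono2) auto
      also have "\<dots> \<le> 2 * real m powr (1/4)"
      proof -
        have "(2::real) powr (1/4) \<le> 2 powr 1" by (intro powr_mono) auto
        then show ?thesis by (simp add: powr_mult mult_right_mono)
      qed
      also have "real m powr (1/4) = sqrt (sqrt m)"
        using m_pos by (simp add: powr_half_sqrt [symmetric] powr_powr)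
      finally have "sqrt c / 2 * real (m0 s\<^sub>X s\<^sub>Y t) powr (1/4) / sqrt n
          \<le> sqrt c / 2 * (2 * sqrt (sqrt m)) / sqrt n"
        using c by (intro divide_right_mono mult_left_mono) auto
      also have "\<dots> = sqrt (\<delta>\<^sup>2 * m)"
        unfolding \<delta>m by (simp add: real_sqrt_divide real_sqrt_mult)
      finally show ?thesis .
    qed
    ultimately show ?thesis
      unfolding t_def [symmetric] by (meson ereal_less_eq(3) order_trans)
  qed
  have pos: "0 < sqrt c / 2" "0 < C'" using c by (auto simp: C'_def)
  show ?thesis
    unfolding \<kappa>_def [symmetric]
    by (rule exI[of _ "sqrt c / 2"], rule conjI[OF pos(1)], rule exI[of _ C'], rule conjI[OF pos(2)])
       (intro allI impI, elim conjE, rule bound)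
qed

end
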